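(* Let $p_1<p_2$ be real numbers, let $N\geqslant 1$ be an integer, let $\rho_1,\rho_2\geqslant 1$ and $0<\mu_1,\mu_2<1$. Let $\psi\in\mathcal{C}^1([p_1,p_2],\mathbb{R})$ satisfy $\psi'(p)=(p-p_1)^{\rho_1-1}(p_2-p)^{\rho_2-1}\tilde\psi(p)$ for all $p\in[p_1,p_2]$, where $\tilde\psi\in\mathcal{C}^N([p_1,p_2],\mathbb{R})$ is positive. Let $U:(p_1,p_2)\to\mathbb{C}$ be given by $U(p)=(p-p_1)^{\mu_1-1}(p_2-p)^{\mu_2-1}\tilde u(p)$ for all $p\in(p_1,p_2)$, where $\tilde u\in\mathcal{C}^N([p_1,p_2],\mathbb{C})$ and $\tilde u(p_j)\neq 0$ for $j=1,2$. Let $s_j$, $k_j$, $\nu_j$, $\Lambda^{(j)}(s)$ be as defined in the context. For $j=1,2$, $\omega>0$ and $n=0,\dots,N-1$ set $$\Theta_{n+1}^{(j)}(\rho_j,\mu_j):=\frac{(-1)^{j+1}}{n!\,\rho_j}\,\Gamma\Big(\frac{n+\mu_j}{\rho_j}\Big)\,e^{(-1)^{j+1}i\frac{\pi}{2}\frac{n+\mu_j}{\rho_j}},$$ $$\phi_{n+1}^{(j)}(s,\omega,\rho_j,\mu_j):=\frac{(-1)^{n+1}}{n!}\int_{\Lambda^{(j)}(s)}(z-s)^n z^{\mu_j-1}e^{(-1)^{j+1}i\omega z^{\rho_j}}\,dz,$$ $$A_N^{(j)}(\omega):=e^{i\omega\psi(p_j)}\sum_{n=0}^{N-1}\Theta_{n+1}^{(j)}(\rho_j,\mu_j)\,\frac{d^n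 k_j}{ds^n}(0)\,\omega^{-\frac{n+\mu_j}{\rho_j}},$$ $$R_N^{(j)}(\omega):=(-1)^{N+1+j}e^{i\omega\psi(p_j)}\int_0^{s_j}\phi_N^{(j)}(s,\omega,\rho_j,\mu_j)\,\frac{d^N}{ds^N}(\nu_jk_j)(s)\,ds.$$ Then for all $\omega>0$, $$\int_{p_1}^{p_2}U(p)e^{i\omega\psi(p)}\,dp=\sum_{j=1,2}\Big(A_N^{(j)}(\omega)+R_N^{(j)}(\omega)\Big),$$ and for $j=1,2$, $$\big|R_N^{(j)}(\omega)\big|\leqslant\frac{1}{(N-1)!}\,\frac{1}{\rho_j}\,\Gamma\Big(\frac{N}{\rho_j}\Big)\int_0^{s_j}s^{\mu_j-1}\left|\frac{d^N}{ds^N}(\nu_jk_j)(s)\right|ds\;\,\omega^{-\frac{N}{\rho_j}}.$$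
   Context: Fix $\eta\in(0,\frac{p_2-p_1}{2})$ and a smooth function $\nu:[p_1,p_2]\to\mathbb{R}$ with $0\leqslant\nu\leqslant 1$, $\nu=1$ on $[p_1,p_1+\eta]$ and $\nu=0$ on $[p_2-\eta,p_2]$. Put $I_1:=[p_1,p_2-\eta]$, $I_2:=[p_1+\eta,p_2]$, and define $\varphi_j:I_j\to\mathbb{R}$ by $\varphi_1(p):=(\psi(p)-\psi(p_1))^{1/\rho_1}$, $\varphi_2(p):=(\psi(p_2)-\psi(p))^{1/\rho_2}$. Put $s_1:=\varphi_1(p_2-\eta)$, $s_2:=\varphi_2(p_1+\eta)$; each $\varphi_j$ is a bijection from $I_j$ onto $[0,s_j]$. For $j=1,2$, $k_j:(0,s_j]\to\mathbb{C}$ is $k_j(s):=U(\varphi_j^{-1}(s))\,s^{1-\mu_j}\,(\varphi_j^{-1})'(s)$, which extends to a $\mathcal{C}^N$ function on $[0,s_j]$ (still denoted $k_j$). Also $\nu_1:=\nu\circ\varphi_1^{-1}$ on $[0,s_1]$ and $\nu_2:=(1-\nu)\circ\varphi_2^{-1}$ on $[0,s_2]$. For $s>0$, $\Lambda^{(j)}(s):=\{s+te^{(-1)^{j+1}i\frac{\pi}{2\rho_j}}\mid t\geqslant 0\}$, oriented by increasing $t$. Complex powers are taken with the principal branch on $\mathbb{C}\setminus(-\infty,0]$. *)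

theory Defs
  imports "HOL-Analysis.Analysis"
begin

text \<open>
  Indexed data such as \<open>p\<^sub>1, p\<^sub>2\<close> are functions on \<^typ>\<open>nat\<close> of which only the
  values at \<open>1\<close> and \<open>2\<close> matter; below, \<open>j\<close> ranges over \<open>{1, 2}\<close>.
\<close>

text \<open>
  Iterated derivatives relative to a set: at the endpoints of a compact interval they are
  one-sided.
\<close>

primrec iter_deriv :: "real set \<Rightarrow> nat \<Rightarrow> (real \<Rightarrow> 'a::real_normed_vector) \<Rightarrow> real \<Rightarrow> 'a" where
  "iter_deriv S 0 f = f"
| "iter_deriv S (Suc n) f = (\<lambda>x. vector_derivative (iter_deriv S n f) (at x within S))"

definition Ck_on :: "nat \<Rightarrow> (real \<Rightarrow> 'a::real_normed_vector) \<Rightarrow> real set \<Rightarrow> bool" where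
  "Ck_on n f S \<longleftrightarrow>
     (\<forall>m<n. \<forall>x\<in>S. iter_deriv S m f differentiable (at x within S)) \<and>
     continuous_on S (iter_deriv S n f)"

text \<open>
  The real power of a nonnegative base with the convention \<open>0\<^sup>0 = 1\<close>; the library has
  \<open>0 powr 0 = 0\<close>, which would be wrong for \<open>(p - p\<^sub>1)\<close> to the power \<open>\<rho>\<^sub>1 - 1\<close> at
  \<open>p = p\<^sub>1\<close> when \<open>\<rho>\<^sub>1 = 1\<close>.
\<close>

definition rpow :: "real \<Rightarrow> real \<Rightarrow> real" where
  "rpow x a = (if a = 0 then 1 else x powr a)"

definition I_int :: "(nat \<Rightarrow> real) \<Rightarrow> real \<Rightarrow> nat \<Rightarrow> real set" where
  "I_int p \<eta> j = (if j = 1 then {p 1..p 2 - \<eta>} else {p 1 + \<eta>..p 2})"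

definition phase :: "(nat \<Rightarrow> real) \<Rightarrow> (nat \<Rightarrow> real) \<Rightarrow> (real \<Rightarrow> real) \<Rightarrow> nat \<Rightarrow> real \<Rightarrow> real" where
  "phase p \<rho> \<psi> j q =
     (if j = 1 then (\<psi> q - \<psi> (p 1)) powr (1 / \<rho> 1) else (\<psi> (p 2) - \<psi> q) powr (1 / \<rho> 2))"

definition s_end :: "(nat \<Rightarrow> real) \<Rightarrow> (nat \<Rightarrow> real) \<Rightarrow> (real \<Rightarrow> real) \<Rightarrow> real \<Rightarrow> nat \<Rightarrow> real" where
  "s_end p \<rho> \<psi> \<eta> j =
     (if j = 1 then phase p \<rho> \<psi> 1 (p 2 - \<eta>) else phase p \<rho> \<psi> 2 (p 1 + \<eta>))"

definition phase_inv ::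
  "(nat \<Rightarrow> real) \<Rightarrow> (nat \<Rightarrow> real) \<Rightarrow> (real \<Rightarrow> real) \<Rightarrow> real \<Rightarrow> nat \<Rightarrow> real \<Rightarrow> real" where
  "phase_inv p \<rho> \<psi> \<eta> j = inv_into (I_int p \<eta> j) (phase p \<rho> \<psi> j)"

definition k_raw ::
  "(nat \<Rightarrow> real) \<Rightarrow> (nat \<Rightarrow> real) \<Rightarrow> (nat \<Rightarrow> real) \<Rightarrow> (real \<Rightarrow> real) \<Rightarrow> (real \<Rightarrow> complex) \<Rightarrow> real
     \<Rightarrow> nat \<Rightarrow> real \<Rightarrow> complex" where
  "k_raw p \<rho> \<mu> \<psi> U \<eta> j s =
     U (phase_inv p \<rho> \<psi> \<eta> j s) * of_real (s powr (1 - \<mu> j)) *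
     of_real (vector_derivative (phase_inv p \<rho> \<psi> \<eta> j) (at s within {0..s_end p \<rho> \<psi> \<eta> j}))"

text \<open>The continuous extension of \<^const>\<open>k_raw\<close> from the half-open interval to \<open>0\<close>.\<close>

definition k_fun ::
  "(nat \<Rightarrow> real) \<Rightarrow> (nat \<Rightarrow> real) \<Rightarrow> (nat \<Rightarrow> real) \<Rightarrow> (real \<Rightarrow> real) \<Rightarrow> (real \<Rightarrow> complex) \<Rightarrow> real
     \<Rightarrow> nat \<Rightarrow> real \<Rightarrow> complex" where
  "k_fun p \<rho> \<mu> \<psi> U \<eta> j s =
     (if s = 0 then Lim (at_right 0) (k_raw p \<rho> \<mu> \<psi> U \<eta> j) else k_raw p \<rho> \<mu> \<psi> U \<eta> j s)"

definition nu_fun ::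
  "(nat \<Rightarrow> real) \<Rightarrow> (nat \<Rightarrow> real) \<Rightarrow> (real \<Rightarrow> real) \<Rightarrow> real \<Rightarrow> (real \<Rightarrow> real) \<Rightarrow> nat \<Rightarrow> real \<Rightarrow> real" where
  "nu_fun p \<rho> \<psi> \<eta> \<nu> j s =
     (if j = 1 then \<nu> (phase_inv p \<rho> \<psi> \<eta> 1 s) else 1 - \<nu> (phase_inv p \<rho> \<psi> \<eta> 2 s))"

definition nu_k_deriv ::
  "(nat \<Rightarrow> real) \<Rightarrow> (nat \<Rightarrow> real) \<Rightarrow> (nat \<Rightarrow> real) \<Rightarrow> (real \<Rightarrow> real) \<Rightarrow> (real \<Rightarrow> complex) \<Rightarrow> real
     \<Rightarrow> (real \<Rightarrow> real) \<Rightarrow> nat \<Rightarrow> nat \<Rightarrow> real \<Rightarrow> complex" where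
  "nu_k_deriv p \<rho> \<mu> \<psi> U \<eta> \<nu> N j =
     iter_deriv {0..s_end p \<rho> \<psi> \<eta> j} N
       (\<lambda>s. of_real (nu_fun p \<rho> \<psi> \<eta> \<nu> j s) * k_fun p \<rho> \<mu> \<psi> U \<eta> j s)"

definition ray_dir :: "nat \<Rightarrow> real \<Rightarrow> complex" where
  "ray_dir j r = exp ((-1) ^ (j + 1) * \<i> * of_real (pi / (2 * r)))"

text \<open>
  Integral along the ray \<open>\<Lambda>\<^sup>(\<^sup>j\<^sup>)(s)\<close>, parametrised by \<open>t \<ge> 0\<close> (the library's contour
  integrals only cover paths on a compact parameter interval).
\<close>

definition ray_integral :: "nat \<Rightarrow> real \<Rightarrow> real \<Rightarrow> (complex \<Rightarrow> complex) \<Rightarrow> complex" where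
  "ray_integral j r s f =
     integral {0..} (\<lambda>t. f (of_real s + of_real t * ray_dir j r) * ray_dir j r)"

text \<open>
  The next two families carry indices starting at \<open>1\<close>; their values at index \<open>0\<close> are
  left unspecified.
\<close>

fun Theta_coeff :: "nat \<Rightarrow> nat \<Rightarrow> real \<Rightarrow> real \<Rightarrow> complex" where
  "Theta_coeff j (Suc n) r m =
     (-1) ^ (j + 1) / of_real (fact n * r) * of_real (Gamma ((real n + m) / r)) *
     exp ((-1) ^ (j + 1) * \<i> * of_real (pi / 2 * ((real n + m) / r)))"

fun phi_fun :: "nat \<Rightarrow> nat \<Rightarrow> real \<Rightarrow> real \<Rightarrow> real \<Rightarrow> real \<Rightarrow> complex" where
  "phi_fun j (Suc n) s \<omega> r m =
     (-1) ^ (n + 1) / of_real (fact n) *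
     ray_integral j r s
       (\<lambda>z. (z - of_real s) ^ n * z powr of_real (m - 1) *
            exp ((-1) ^ (j + 1) * \<i> * of_real \<omega> * z powr of_real r))"

definition A_term ::
  "(nat \<Rightarrow> real) \<Rightarrow> (nat \<Rightarrow> real) \<Rightarrow> (nat \<Rightarrow> real) \<Rightarrow> (real \<Rightarrow> real) \<Rightarrow> (real \<Rightarrow> complex) \<Rightarrow> real
     \<Rightarrow> nat \<Rightarrow> nat \<Rightarrow> real \<Rightarrow> complex" where
  "A_term p \<rho> \<mu> \<psi> U \<eta> N j \<omega> =
     exp (\<i> * of_real (\<omega> * \<psi> (p j))) *
     (\<Sum>n<N. Theta_coeff j (Suc n) (\<rho> j) (\<mu> j) *
        iter_deriv {0..s_end p \<rho> \<psi> \<eta> j} n (k_fun p \<rho> \<mu> \<psi> U \<eta> j) 0 *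
        of_real (\<omega> powr (- ((real n + \<mu> j) / \<rho> j))))"

definition R_term ::
  "(nat \<Rightarrow> real) \<Rightarrow> (nat \<Rightarrow> real) \<Rightarrow> (nat \<Rightarrow> real) \<Rightarrow> (real \<Rightarrow> real) \<Rightarrow> (real \<Rightarrow> complex) \<Rightarrow> real
     \<Rightarrow> (real \<Rightarrow> real) \<Rightarrow> nat \<Rightarrow> nat \<Rightarrow> real \<Rightarrow> complex" where
  "R_term p \<rho> \<mu> \<psi> U \<eta> \<nu> N j \<omega> =
     (-1) ^ (N + 1 + j) * exp (\<i> * of_real (\<omega> * \<psi> (p j))) *
     integral {0..s_end p \<rho> \<psi> \<eta> j}
       (\<lambda>s. phi_fun j N s \<omega> (\<rho> j) (\<mu> j) * nu_k_deriv p \<rho> \<mu> \<psi> U \<eta> \<nu> N j s)"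

end

theory Submission
  imports Defs "HOL-Real_Asymp.Real_Asymp"
begin

text \<open>
  The cut-off \<open>\<nu>\<close> splits the integral into two pieces, each with one singular endpoint \<open>p\<^sub>j\<close>.
  In the coordinate \<open>x \<ge> 0\<close> measuring the distance to \<open>p\<^sub>j\<close>, the phase is \<open>x\<^sup>\<rho> J(x)\<close> with
  \<open>J(x) = \<integral>\<^sub>0\<^sup>1 y\<^sup>\<rho>\<^sup>-\<^sup>1 h(y x) dy\<close> positive and as smooth as \<open>h\<close>, so that \<open>s = x J(x)\<^sup>1\<^sup>/\<^sup>\<rho>\<close> is a
  \<open>C\<^sup>N\<^sup>+\<^sup>1\<close> coordinate in which the piece becomes the integral of \<open>\<nu>\<^sub>j k\<^sub>j\<close> against
  \<open>s\<^sup>\<mu>\<^sup>-\<^sup>1 exp (\<plusminus> \<i> \<omega> s\<^sup>\<rho>)\<close>. Integrating by parts \<open>N\<close> times with the primitives \<open>\<phi>\<^sub>n\<close> gives the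
  expansion: nothing is contributed at \<open>s\<^sub>j\<close>, where all derivatives of \<open>\<nu>\<^sub>j\<close> vanish, and at \<open>0\<close> the
  primitives are Gamma integrals. On the ray \<open>z = s + t e\<^sup>\<plusminus>\<^sup>i\<^sup>\<pi>\<^sup>/\<^sup>2\<^sup>\<rho>\<close> one has \<open>|z| \<ge> s\<close> and
  \<open>\<plusminus> Im z\<^sup>\<rho> \<ge> t\<^sup>\<rho>\<close>, which bounds \<open>\<phi>\<^sub>N\<close>. That \<open>\<phi>\<^sub>n\<^sub>+\<^sub>1' = \<phi>\<^sub>n\<close> needs no contour deformation: the
  derivative in \<open>s\<close> of the integrand is, up to a constant factor, a derivative in \<open>t\<close>.
\<close>

section \<open>Functions of class \<open>C\<^sup>k\<close> on compact intervals\<close>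

text \<open>The recursion of \<open>iter_deriv\<close> peels off the outermost derivative. Peeling
  off the innermost one instead allows induction on the order with the function replaced by its
  derivative, which is how the closure properties below are proved.\<close>

lemma iter_deriv_Suc_shift:
  "iter_deriv S (Suc n) f = iter_deriv S n (\<lambda>x. vector_derivative f (at x within S))"
  by (induction n) auto

text \<open>A derivative within \<open>S\<close> at a point sees only the points of \<open>S\<close>
  near it. This locality is used where the cut-off is constant.\<close>

lemma iter_deriv_cong_open:
  assumes "open T" "\<And>y. y \<in> S \<inter> T \<Longrightarrow> f y = g y" "x \<in> S \<inter> T"
  shows "iter_deriv S n f x = iter_deriv S n g x"
  using assms(3)
proof (induction n arbitrary: x)
  case (Suc n)
  have "\<forall>\<^sub>F y in nhds x. y \<in> T"
    using assms(1) Suc.prems eventually_nhds_in_open by blast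
  then have "\<forall>\<^sub>F y in nhds x. y \<in> S \<longrightarrow> iter_deriv S n f y = iter_deriv S n g y"
    by eventually_elim (use Suc.IH in auto)
  then show ?case
    using Suc.prems by (auto intro!: vector_derivative_cong_eq)
qed (use assms in auto)

lemma iter_deriv_cong:
  assumes "\<And>y. y \<in> S \<Longrightarrow> f y = g y" "x \<in> S"
  shows "iter_deriv S n f x = iter_deriv S n g x"
  using iter_deriv_cong_open[of UNIV S f g x n] assms by simp

lemma Ck_on_transfer:
  assumes "\<And>y. y \<in> S \<Longrightarrow> f y = g y" "Ck_on n f S"
  shows "Ck_on n g S"
proof -
  have eq: "iter_deriv S m f y = iter_deriv S m g y" if "y \<in> S" for m y
    using iter_deriv_cong[of S f g y m] assms(1) that by blast
  have "iter_deriv S m g differentiable at x within S" if "x \<in> S" "m < n" for m x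
    by (rule differentiable_transform_within[where f = "iter_deriv S m f", OF _ zero_less_one \<open>x \<in> S\<close>])
      (use assms(2) that eq in \<open>auto simp: Ck_on_def\<close>)
  moreover have "continuous_on S (iter_deriv S n f)"
    using assms(2) by (simp add: Ck_on_def)
  then have "continuous_on S (iter_deriv S n g)"
    by (rule continuous_on_eq) (rule eq)
  ultimately show ?thesis by (simp add: Ck_on_def)
qed

lemma Ck_on_cong:
  assumes "\<And>y. y \<in> S \<Longrightarrow> f y = g y"
  shows "Ck_on n f S \<longleftrightarrow> Ck_on n g S"
  using Ck_on_transfer[of S f g n] Ck_on_transfer[of S g f n] assms by auto

lemma Ck_on_0 [simp]: "Ck_on 0 f S \<longleftrightarrow> continuous_on S f"
  by (simp add: Ck_on_def)

lemma Ck_on_Suc_iff: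
  "Ck_on (Suc n) f S \<longleftrightarrow> (\<forall>x\<in>S. f differentiable (at x within S)) \<and>
     Ck_on n (\<lambda>x. vector_derivative f (at x within S)) S"
  unfolding Ck_on_def iter_deriv_Suc_shift[symmetric] All_less_Suc2 by auto

lemma Ck_on_SucE_iter:
  assumes "Ck_on (Suc n) f S"
  obtains f' where "\<And>x. x \<in> S \<Longrightarrow> (f has_vector_derivative f' x) (at x within S)" "Ck_on n f' S"
    "\<And>m. iter_deriv S (Suc m) f = iter_deriv S m f'"
  using assms that[of "\<lambda>x. vector_derivative f (at x within S)"]
  unfolding Ck_on_Suc_iff iter_deriv_Suc_shift by (auto simp: vector_derivative_works)

lemma Ck_on_SucE:
  assumes "Ck_on (Suc n) f S"
  obtains f' where "\<And>x. x \<in> S \<Longrightarrow> (f has_vector_derivative f' x) (at x within S)" "Ck_on n f' S"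
  by (rule Ck_on_SucE_iter[OF assms], rule that)

text \<open>On a nondegenerate interval even the one-sided derivatives are unique, so any explicit
  \<open>f'\<close> may stand for the value chosen by \<open>vector_derivative\<close>. This is why
  \<open>a < b\<close> recurs throughout.\<close>

lemma iter_deriv_Suc_Icc:
  fixes f :: "real \<Rightarrow> 'a::real_normed_vector"
  assumes "a < b" "\<And>x. x \<in> {a..b} \<Longrightarrow> (f has_vector_derivative f' x) (at x within {a..b})"
    "x \<in> {a..b}"
  shows "iter_deriv {a..b} (Suc m) f x = iter_deriv {a..b} m f' x"
proof -
  have "vector_derivative f (at y within {a..b}) = f' y" if "y \<in> {a..b}" for y
    using vector_derivative_within_cbox[of a b y f "f' y"] assms that by auto
  then show ?thesis
    unfolding iter_deriv_Suc_shift using assms(3) by (intro iter_deriv_cong) auto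
qed

lemma Ck_on_SucI:
  fixes f :: "real \<Rightarrow> 'a::real_normed_vector"
  assumes "a < b" "\<And>x. x \<in> {a..b} \<Longrightarrow> (f has_vector_derivative f' x) (at x within {a..b})"
    "Ck_on n f' {a..b}"
  shows "Ck_on (Suc n) f {a..b}"
proof -
  have "vector_derivative f (at y within {a..b}) = f' y" if "y \<in> {a..b}" for y
    using vector_derivative_within_cbox[of a b y f "f' y"] assms that by auto
  then have "Ck_on n (\<lambda>x. vector_derivative f (at x within {a..b})) {a..b}"
    using Ck_on_cong[of "{a..b}" "\<lambda>x. vector_derivative f (at x within {a..b})" f'] assms(3) by blast
  then show ?thesis
    unfolding Ck_on_Suc_iff using assms(2) differentiableI_vector by blast
qed

lemma Ck_on_imp_continuous_on: "Ck_on n f S \<Longrightarrow> continuous_on S f"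
  by (cases n)
    (auto simp: Ck_on_Suc_iff intro!: differentiable_imp_continuous_on
      differentiable_on_def[THEN iffD2])

lemma Ck_on_SucD: "Ck_on (Suc n) f S \<Longrightarrow> Ck_on n f S"
proof (induction n arbitrary: f)
  case 0
  then show ?case by (simp add: Ck_on_imp_continuous_on)
next
  case (Suc n)
  then show ?case by (subst Ck_on_Suc_iff) (use Ck_on_Suc_iff in blast)
qed

lemma Ck_on_le: "Ck_on n f S \<Longrightarrow> m \<le> n \<Longrightarrow> Ck_on m f S"
proof (induction n)
  case (Suc n)
  then show ?case by (cases "m = Suc n") (auto dest: Ck_on_SucD)
qed auto

lemma Ck_on_has_vector_derivative:
  assumes "Ck_on n f S" "m < n" "x \<in> S"
  shows "(iter_deriv S m f has_vector_derivative iter_deriv S (Suc m) f x) (at x within S)"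
  using assms by (simp add: Ck_on_def vector_derivative_works)

lemma Ck_on_continuous_on_iter_deriv:
  assumes "Ck_on n f S" "m \<le> n"
  shows "continuous_on S (iter_deriv S m f)"
  using Ck_on_le[OF assms] by (simp add: Ck_on_def)

lemma Ck_on_const: "Ck_on n (\<lambda>x. c) {a..b}" if "a < b"
proof (induction n arbitrary: c)
  case (Suc n)
  show ?case by (rule Ck_on_SucI[OF that, where f' = "\<lambda>_. 0"]) (use Suc in auto)
qed auto

lemma Ck_on_bounded_linear:
  assumes "a < b" "bounded_linear h" "Ck_on n f {a..b}"
  shows "Ck_on n (\<lambda>x. h (f x)) {a..b}"
  using assms(3)
proof (induction n arbitrary: f)
  case 0
  then show ?case using bounded_linear.continuous_on[OF assms(2)] by simp
next
  case (Suc n)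
  obtain f' where f': "\<And>x. x \<in> {a..b} \<Longrightarrow> (f has_vector_derivative f' x) (at x within {a..b})"
    "Ck_on n f' {a..b}"
    by (rule Ck_on_SucE[OF Suc.prems]) (rule that)
  show ?case
    using f' Suc.IH
    by (intro Ck_on_SucI[OF assms(1), where f' = "\<lambda>x. h (f' x)"]
        bounded_linear.has_vector_derivative[OF assms(2)])
qed

lemma Ck_on_add:
  assumes "a < b" "Ck_on n f {a..b}" "Ck_on n g {a..b}"
  shows "Ck_on n (\<lambda>x. f x + g x) {a..b}"
  using assms(2,3)
proof (induction n arbitrary: f g)
  case 0
  then show ?case by (simp add: continuous_on_add)
next
  case (Suc n)
  obtain f' where f': "\<And>x. x \<in> {a..b} \<Longrightarrow> (f has_vector_derivative f' x) (at x within {a..b})"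
    "Ck_on n f' {a..b}"
    by (rule Ck_on_SucE[OF Suc.prems(1)]) (rule that)
  obtain g' where g': "\<And>x. x \<in> {a..b} \<Longrightarrow> (g has_vector_derivative g' x) (at x within {a..b})"
    "Ck_on n g' {a..b}"
    by (rule Ck_on_SucE[OF Suc.prems(2)]) (rule that)
  show ?case
    using f' g' Suc.IH
    by (intro Ck_on_SucI[OF assms(1), where f' = "\<lambda>x. f' x + g' x"] has_vector_derivative_add)
qed

text \<open>The product rule for an arbitrary bounded bilinear map covers multiplication and scaling
  at once.\<close>

lemma Ck_on_bilinear:
  assumes "a < b" "bounded_bilinear h" "Ck_on n f {a..b}" "Ck_on n g {a..b}"
  shows "Ck_on n (\<lambda>x. h (f x) (g x)) {a..b}"
  using assms(3,4)
proof (induction n arbitrary: f g)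
  case 0
  then show ?case using bounded_bilinear.continuous_on[OF assms(2)] by simp
next
  case (Suc n)
  obtain f' where f': "\<And>x. x \<in> {a..b} \<Longrightarrow> (f has_vector_derivative f' x) (at x within {a..b})"
    "Ck_on n f' {a..b}"
    by (rule Ck_on_SucE[OF Suc.prems(1)]) (rule that)
  obtain g' where g': "\<And>x. x \<in> {a..b} \<Longrightarrow> (g has_vector_derivative g' x) (at x within {a..b})"
    "Ck_on n g' {a..b}"
    by (rule Ck_on_SucE[OF Suc.prems(2)]) (rule that)
  show ?case
    using f' g' Suc.IH Suc.prems[THEN Ck_on_SucD]
    by (intro Ck_on_SucI[OF assms(1), where f' = "\<lambda>x. h (f x) (g' x) + h (f' x) (g x)"]
        bounded_bilinear.has_vector_derivative[OF assms(2)] Ck_on_add[OF assms(1)])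
qed

lemmas Ck_on_mult = Ck_on_bilinear[OF _ bounded_bilinear_mult]
lemmas Ck_on_scaleR = Ck_on_bilinear[OF _ bounded_bilinear_scaleR]
lemmas Ck_on_of_real = Ck_on_bounded_linear[OF _ bounded_linear_of_real]

lemma has_vector_derivative_compose_within:
  assumes "(g has_vector_derivative g') (at x within A)"
    "(f has_vector_derivative f') (at (g x) within B)" "g ` A \<subseteq> B"
  shows "((\<lambda>x. f (g x)) has_vector_derivative g' *\<^sub>R f') (at x within A)"
  using vector_diff_chain_within[OF assms(1) has_vector_derivative_within_subset[OF assms(2,3)]]
  by (simp add: o_def)

text \<open>The derivative is \<open>g'\<close> times a composite of \<open>f'\<close> with the same
  \<open>g\<close>, so the induction varies \<open>f\<close> and keeps \<open>g\<close>.\<close>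

lemma Ck_on_compose:
  fixes g :: "real \<Rightarrow> real"
  assumes "a < b" "Ck_on n f {c..d}" "Ck_on n g {a..b}" "g ` {a..b} \<subseteq> {c..d}"
  shows "Ck_on n (\<lambda>x. f (g x)) {a..b}"
  using assms(2,3)
proof (induction n arbitrary: f)
  case 0
  then show ?case using assms(4) by (auto intro: continuous_on_compose2)
next
  case (Suc n)
  obtain f' where f': "\<And>x. x \<in> {c..d} \<Longrightarrow> (f has_vector_derivative f' x) (at x within {c..d})"
    "Ck_on n f' {c..d}"
    by (rule Ck_on_SucE[OF Suc.prems(1)]) (rule that)
  obtain g' where g': "\<And>x. x \<in> {a..b} \<Longrightarrow> (g has_vector_derivative g' x) (at x within {a..b})"
    "Ck_on n g' {a..b}"
    by (rule Ck_on_SucE[OF Suc.prems(2)]) (rule that)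
  have "((\<lambda>x. f (g x)) has_vector_derivative g' x *\<^sub>R f' (g x)) (at x within {a..b})"
    if "x \<in> {a..b}" for x
    using assms(4) by (intro has_vector_derivative_compose_within[of _ _ _ _ _ _ "{c..d}"] f' g' that) (use that in blast)+
  moreover have "Ck_on n (\<lambda>x. g' x *\<^sub>R f' (g x)) {a..b}"
    using Suc.IH[OF f'(2)] g'(2) Ck_on_SucD[OF Suc.prems(2)] by (intro Ck_on_scaleR assms(1))
  ultimately show ?case by (rule Ck_on_SucI[OF assms(1)])
qed

lemma Ck_on_ident: "Ck_on n (\<lambda>x::real. x) {a..b}" if "a < b"
  by (cases n) (simp_all add: Ck_on_SucI[OF that, where f' = "\<lambda>_. 1"] Ck_on_const[OF that]
      has_vector_derivative_id continuous_on_id)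

text \<open>The exponent is generalised in the induction, because differentiation lowers it by one.
  Exponent \<open>-1\<close> later provides reciprocals.\<close>

lemma Ck_on_powr:
  fixes f :: "real \<Rightarrow> real"
  assumes "a < b" "Ck_on n f {a..b}" "\<And>x. x \<in> {a..b} \<Longrightarrow> f x > 0"
  shows "Ck_on n (\<lambda>x. f x powr c) {a..b}"
  using assms(2)
proof (induction n arbitrary: c)
  case 0
  then show ?case using assms(3) by (auto intro!: continuous_on_powr) (metis less_irrefl)
next
  case (Suc n)
  obtain f' where f': "\<And>x. x \<in> {a..b} \<Longrightarrow> (f has_vector_derivative f' x) (at x within {a..b})"
    "Ck_on n f' {a..b}"
    by (rule Ck_on_SucE[OF Suc.prems(1)]) (rule that)
  have "((\<lambda>x. f x powr c) has_vector_derivative f' x * (c * f x powr (c - 1))) (at x within {a..b})"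
    if "x \<in> {a..b}" for x
    using f'(1)[OF that] assms(3)[OF that] unfolding has_real_derivative_iff_has_vector_derivative[symmetric]
    by (auto intro!: derivative_eq_intros simp: powr_diff field_simps)
  moreover have "Ck_on n (\<lambda>x. f' x * (c * f x powr (c - 1))) {a..b}"
    using Suc.IH f'(2) Ck_on_SucD[OF Suc.prems] by (intro Ck_on_mult Ck_on_const assms(1))
  ultimately show ?case by (rule Ck_on_SucI[OF assms(1)])
qed

lemma iter_deriv_subinterval:
  assumes "Ck_on n f {a..b}" "a \<le> c" "c < d" "d \<le> b" "m \<le> n" "x \<in> {c..d}"
  shows "iter_deriv {c..d} m f x = iter_deriv {a..b} m f x"
  using assms(1,5)
proof (induction m arbitrary: f n)
  case (Suc m)
  then obtain k where n: "n = Suc k" by (cases n) auto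
  obtain f' where f': "\<And>x. x \<in> {a..b} \<Longrightarrow> (f has_vector_derivative f' x) (at x within {a..b})"
    "Ck_on k f' {a..b}"
    by (rule Ck_on_SucE[OF Suc.prems(1)[unfolded n]]) (rule that)
  have "iter_deriv {c..d} (Suc m) f x = iter_deriv {c..d} m f' x"
    using assms(2,3,4,6) has_vector_derivative_within_subset[OF f'(1), of _ "{c..d}"]
    by (intro iter_deriv_Suc_Icc) auto
  also have "\<dots> = iter_deriv {a..b} m f' x"
    using Suc f'(2) n by auto
  also have "\<dots> = iter_deriv {a..b} (Suc m) f x"
    using f'(1) assms(2,3,4,6) by (intro iter_deriv_Suc_Icc[symmetric]) auto
  finally show ?case .
qed auto

section \<open>Functions vanishing to a given order at a point\<close>

text \<open>Smoothness is bundled with the vanishing of the derivatives, since the inductions for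
  products and composites need both together.\<close>

definition flat_at :: "nat \<Rightarrow> (real \<Rightarrow> 'a::real_normed_vector) \<Rightarrow> real set \<Rightarrow> real \<Rightarrow> bool" where
  "flat_at n f S c \<longleftrightarrow> Ck_on n f S \<and> (\<forall>m\<le>n. iter_deriv S m f c = 0)"

lemma flat_at_SucE:
  assumes "flat_at (Suc n) f S c"
  obtains f' where "\<And>x. x \<in> S \<Longrightarrow> (f has_vector_derivative f' x) (at x within S)"
    "flat_at n f' S c" "f c = 0"
proof -
  obtain f' where f': "\<And>x. x \<in> S \<Longrightarrow> (f has_vector_derivative f' x) (at x within S)"
    "Ck_on n f' S" "\<And>m. iter_deriv S (Suc m) f = iter_deriv S m f'"
    by (rule Ck_on_SucE_iter[OF assms[unfolded flat_at_def, THEN conjunct1]]) (rule that)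
  have "iter_deriv S m f' c = 0" if "m \<le> n" for m
    using assms that f'(3)[of m] unfolding flat_at_def by (metis Suc_le_mono)
  moreover have "f c = 0"
    using assms unfolding flat_at_def by (metis iter_deriv.simps(1) le0)
  ultimately show ?thesis using that f' unfolding flat_at_def by blast
qed

lemma flat_at_SucI:
  fixes f :: "real \<Rightarrow> 'a::real_normed_vector"
  assumes "a < b" "\<And>x. x \<in> {a..b} \<Longrightarrow> (f has_vector_derivative f' x) (at x within {a..b})"
    "flat_at n f' {a..b} c" "f c = 0" "c \<in> {a..b}"
  shows "flat_at (Suc n) f {a..b} c"
proof -
  have "iter_deriv {a..b} m f c = 0" if "m \<le> Suc n" for m
  proof (cases m)
    case (Suc k)
    then show ?thesis
      using iter_deriv_Suc_Icc[OF assms(1,2,5), of k] assms(3) that by (simp add: flat_at_def)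
  qed (use assms in auto)
  then show ?thesis
    using assms Ck_on_SucI[OF assms(1,2)] unfolding flat_at_def by blast
qed

lemma flat_at_0 [simp]: "flat_at 0 f S c \<longleftrightarrow> continuous_on S f \<and> f c = 0"
  by (simp add: flat_at_def)

lemma flat_at_le: "flat_at n f S c \<Longrightarrow> m \<le> n \<Longrightarrow> flat_at m f S c"
  unfolding flat_at_def using Ck_on_le by fastforce

lemma flat_at_add:
  assumes "a < b" "c \<in> {a..b}" "flat_at n f {a..b} c" "flat_at n g {a..b} c"
  shows "flat_at n (\<lambda>x. f x + g x) {a..b} c"
  using assms(3,4)
proof (induction n arbitrary: f g)
  case 0
  then show ?case by (simp add: continuous_on_add)
next
  case (Suc n)
  obtain f' where f': "\<And>x. x \<in> {a..b} \<Longrightarrow> (f has_vector_derivative f' x) (at x within {a..b})"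
    "flat_at n f' {a..b} c" "f c = 0"
    by (rule flat_at_SucE[OF Suc.prems(1)]) (rule that)
  obtain g' where g': "\<And>x. x \<in> {a..b} \<Longrightarrow> (g has_vector_derivative g' x) (at x within {a..b})"
    "flat_at n g' {a..b} c" "g c = 0"
    by (rule flat_at_SucE[OF Suc.prems(2)]) (rule that)
  show ?case
    using f' g' Suc.IH
    by (intro flat_at_SucI[OF assms(1), where f' = "\<lambda>x. f' x + g' x"] has_vector_derivative_add
        assms(2)) auto
qed

text \<open>Both Leibniz terms keep a flat factor, \<open>f\<close> or \<open>f'\<close>, so
  flatness survives multiplication by any smooth function.\<close>

lemma flat_at_bilinear:
  assumes "a < b" "c \<in> {a..b}" "bounded_bilinear h" "flat_at n f {a..b} c" "Ck_on n g {a..b}"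
  shows "flat_at n (\<lambda>x. h (f x) (g x)) {a..b} c"
  using assms(4,5)
proof (induction n arbitrary: f g)
  case 0
  then show ?case by (simp add: bounded_bilinear.continuous_on[OF assms(3)] bounded_bilinear.zero_left[OF assms(3)])
next
  case (Suc n)
  obtain f' where f': "\<And>x. x \<in> {a..b} \<Longrightarrow> (f has_vector_derivative f' x) (at x within {a..b})"
    "flat_at n f' {a..b} c" "f c = 0"
    by (rule flat_at_SucE[OF Suc.prems(1)]) (rule that)
  obtain g' where g': "\<And>x. x \<in> {a..b} \<Longrightarrow> (g has_vector_derivative g' x) (at x within {a..b})"
    "Ck_on n g' {a..b}"
    by (rule Ck_on_SucE[OF Suc.prems(2)]) (rule that)
  have "flat_at n f {a..b} c" using flat_at_le[OF Suc.prems(1)] by simp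
  then show ?case
    using f' g' Suc.IH Suc.prems(2)[THEN Ck_on_SucD] bounded_bilinear.zero_left[OF assms(3)]
    by (intro flat_at_SucI[OF assms(1), where f' = "\<lambda>x. h (f x) (g' x) + h (f' x) (g x)"]
        bounded_bilinear.has_vector_derivative[OF assms(3)] flat_at_add[OF assms(1)] assms(2)) auto
qed

lemma flat_at_compose:
  fixes g :: "real \<Rightarrow> real"
  assumes "a < b" "x0 \<in> {a..b}" "flat_at n f {c..d} (g x0)" "Ck_on n g {a..b}" "g ` {a..b} \<subseteq> {c..d}"
  shows "flat_at n (\<lambda>x. f (g x)) {a..b} x0"
  using assms(3,4)
proof (induction n arbitrary: f)
  case 0
  then show ?case using assms(5) by (auto intro: continuous_on_compose2)
next
  case (Suc n)
  obtain f' where f': "\<And>x. x \<in> {c..d} \<Longrightarrow> (f has_vector_derivative f' x) (at x within {c..d})"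
    "flat_at n f' {c..d} (g x0)" "f (g x0) = 0"
    by (rule flat_at_SucE[OF Suc.prems(1)]) (rule that)
  obtain g' where g': "\<And>x. x \<in> {a..b} \<Longrightarrow> (g has_vector_derivative g' x) (at x within {a..b})"
    "Ck_on n g' {a..b}"
    by (rule Ck_on_SucE[OF Suc.prems(2)]) (rule that)
  have "((\<lambda>x. f (g x)) has_vector_derivative g' x *\<^sub>R f' (g x)) (at x within {a..b})"
    if "x \<in> {a..b}" for x
    using assms(5) by (intro has_vector_derivative_compose_within[of _ _ _ _ _ _ "{c..d}"] f' g' that) (use that in blast)+
  moreover have "flat_at n (\<lambda>x. g' x *\<^sub>R f' (g x)) {a..b} x0"
    using flat_at_bilinear[OF assms(1,2) bounded_bilinear.flip[OF bounded_bilinear_scaleR]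
        Suc.IH[OF f'(2)] g'(2)] Ck_on_SucD[OF Suc.prems(2)] by auto
  ultimately show ?case by (intro flat_at_SucI[OF assms(1)]) (use assms(2) f'(3) in auto)
qed

text \<open>To the right of \<open>c\<close> all derivatives vanish by locality, hence also at
  \<open>c\<close> by continuity. Restricting the interval to \<open>{a..c}\<close> does not change
  the derivatives at \<open>c\<close>.\<close>

lemma flat_at_subinterval:
  fixes f :: "real \<Rightarrow> 'a::real_normed_vector"
  assumes "Ck_on n f {a..b}" "a < c" "c < b" "\<And>x. x \<in> {c..b} \<Longrightarrow> f x = 0"
  shows "flat_at n f {a..c} c"
proof -
  have 0: "iter_deriv {a..b} m f x = 0" if "x \<in> {c<..b}" for x m
  proof -
    have "iter_deriv {a..b} m f x = iter_deriv {a..b} m (\<lambda>_. 0::'a) x"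
      by (rule iter_deriv_cong_open[of "{c<..}"]) (use that assms in auto)
    also have "\<dots> = 0"
    proof (induction m)
      case (Suc m)
      have "iter_deriv {a..b} (Suc m) (\<lambda>_. 0::'a) x = iter_deriv {a..b} m (\<lambda>_. 0::'a) x"
        by (rule iter_deriv_Suc_Icc) (use that assms in auto)
      then show ?case using Suc by simp
    qed simp
    finally show ?thesis .
  qed
  have "iter_deriv {a..c} m f c = 0" if m: "m \<le> n" for m
  proof -
    have "continuous_on {c..b} (iter_deriv {a..b} m f)"
      using Ck_on_continuous_on_iter_deriv[OF assms(1) m] assms(2)
      by (auto intro: continuous_on_subset)
    then have "iter_deriv {a..b} m f c = 0"
      using continuous_constant_on_closure[of "{c<..b}" "iter_deriv {a..b} m f" 0 c] 0 assms
      by (simp add: closure_greaterThanAtMost)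
    then show ?thesis
      using iter_deriv_subinterval[OF assms(1) _ _ _ m, of a c c] assms by auto
  qed
  moreover have "Ck_on n f {a..c}"
    using Ck_on_compose[of a c n f a b "\<lambda>x. x"] Ck_on_ident assms by auto
  ultimately show ?thesis by (auto simp: flat_at_def)
qed

section \<open>Dilation averages and inverse functions\<close>

text \<open>Differentiating under the integral replaces \<open>h\<close> by \<open>h'\<close> and
  the weight \<open>w y\<close> by \<open>w y * y\<close>; hence the weight is generalised in the
  induction. It is only continuous, which admits \<open>y\<close> to the power
  \<open>r - 1\<close>.\<close>

lemma Ck_on_weighted_dilation:
  fixes h w :: "real \<Rightarrow> real"
  assumes "0 < L" "Ck_on n h {0..L}" "continuous_on {0..1} w"
  shows "Ck_on n (\<lambda>x. integral {0..1} (\<lambda>y. w y * h (y * x))) {0..L}"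
  using assms(2,3)
proof (induction n arbitrary: h w)
  case 0
  have "continuous_on ({0..L} \<times> cbox 0 1) (\<lambda>(x, y). w y * h (y * x))"
    unfolding split_beta using 0
    by (intro continuous_intros)
      (auto intro!: continuous_intros mult_left_le_one_le
        order_trans[OF mult_left_le_one_le]
        intro: continuous_on_compose2[of "{0..1}" w] continuous_on_compose2[of "{0..L}" h])
  then show ?case
    using integral_continuous_on_param[of "{0..L}" 0 1 "\<lambda>x y. w y * h (y * x)"] by simp
next
  case (Suc n)
  obtain h' where h': "\<And>x. x \<in> {0..L} \<Longrightarrow> (h has_vector_derivative h' x) (at x within {0..L})"
    "Ck_on n h' {0..L}"
    by (rule Ck_on_SucE[OF Suc.prems(1)]) (rule that)
  have sub: "y * x \<in> {0..L}" if "x \<in> {0..L}" "y \<in> {0..1}" for x y :: real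
    using that mult_left_le_one_le[of x y] by auto
  have d: "((\<lambda>x. w y * h (y * x)) has_vector_derivative (w y * y) * h' (y * x)) (at x within {0..L})"
    if "x \<in> {0..L}" "y \<in> {0..1}" for x y
  proof -
    have "((\<lambda>x. h (y * x)) has_vector_derivative y *\<^sub>R h' (y * x)) (at x within {0..L})"
      using sub that by (intro has_vector_derivative_compose_within[where B = "{0..L}"] h')
        (auto intro!: derivative_eq_intros simp: has_real_derivative_iff_has_vector_derivative[symmetric])
    then show ?thesis
      using has_vector_derivative_mult_right[of _ _ _ "w y"] by (fastforce simp: mult.assoc)
  qed
  have c: "continuous_on ({0..L} \<times> {0..1}) (\<lambda>(x, y). (w y * y) * h' (y * x))"
    unfolding split_beta using sub
    by (intro continuous_on_mult continuous_on_snd continuous_on_id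
        continuous_on_compose2[OF Suc.prems(2) continuous_on_snd]
        continuous_on_compose2[OF Ck_on_imp_continuous_on[OF h'(2)]] continuous_intros) auto
  have "continuous_on {0..1} (\<lambda>y. w y * h (y * x))" if "x \<in> {0..L}" for x
    using sub[OF that]
    by (intro continuous_intros Suc.prems continuous_on_compose2[OF Ck_on_imp_continuous_on[OF Suc.prems(1)]]) auto
  then have "((\<lambda>x. integral {0..1} (\<lambda>y. w y * h (y * x))) has_vector_derivative
      integral {0..1} (\<lambda>y. (w y * y) * h' (y * x))) (at x within {0..L})" if "x \<in> {0..L}" for x
    using leibniz_rule_vector_derivative[of "{0..L}" 0 1 "\<lambda>x y. w y * h (y * x)" "\<lambda>x y. (w y * y) * h' (y * x)" x]
      d c that by (auto intro: integrable_continuous_interval)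
  moreover have "Ck_on n (\<lambda>x. integral {0..1} (\<lambda>y. (w y * y) * h' (y * x))) {0..L}"
    using h'(2) Suc.prems(2) by (intro Suc.IH continuous_intros)
  ultimately show ?case
    by (rule Ck_on_SucI[OF assms(1)])
qed

text \<open>Bootstrapping from \<open>X' = 1 / d (X s)\<close>: if \<open>X\<close> is of class m
  with m at most \<open>n\<close>, the right side is of class m too, so \<open>X\<close> gains one
  order. The start is continuity of the inverse on a compact interval.\<close>

lemma Ck_on_inverse_function:
  fixes f X d :: "real \<Rightarrow> real"
  assumes "a < b" "c < e" "\<And>x. x \<in> {a..b} \<Longrightarrow> (f has_vector_derivative d x) (at x within {a..b})"
    "Ck_on n d {a..b}" "\<And>x. x \<in> {a..b} \<Longrightarrow> d x > 0"
    and X: "\<And>s. s \<in> {c..e} \<Longrightarrow> X s \<in> {a..b} \<and> f (X s) = s" and f: "\<And>x. x \<in> {a..b} \<Longrightarrow> f x \<in> {c..e} \<and> X (f x) = x"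
  shows "\<And>s. s \<in> {c..e} \<Longrightarrow> (X has_vector_derivative 1 / d (X s)) (at s within {c..e})"
    and "Ck_on (Suc n) X {c..e}"
proof -
  have contf: "continuous_on {a..b} f"
    using assms(3) by (meson continuous_on_eq_continuous_within has_vector_derivative_continuous)
  have img: "f ` {a..b} = {c..e}"
    using X f by (force simp: image_iff)
  have contX: "continuous_on {c..e} X"
    using continuous_on_inv[OF contf, of X] f img by auto
  show der: "(X has_vector_derivative 1 / d (X s)) (at s within {c..e})" if s: "s \<in> {c..e}" for s
  proof -
    have "(X has_derivative (\<lambda>h. h * (1 / d (X s)))) (at s within {c..e})"
    proof -
      have "(f has_derivative (\<lambda>h. h * d (X s))) (at (X s) within {a..b})"
        using assms(3)[of "X s"] X[OF s] by (simp add: has_vector_derivative_def)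
      then show ?thesis
        using has_derivative_inverse_within[of f "\<lambda>h. h * d (X s)" "X s" "{a..b}" X "\<lambda>h. h * (1 / d (X s))"]
          X[OF s] contX f img assms(5)[of "X s"] s
        by (auto simp: fun_eq_iff continuous_on_eq_continuous_within bounded_linear.linear[OF bounded_linear_divide])
    qed
    then show ?thesis by (simp add: has_vector_derivative_def)
  qed
  have "Ck_on m X {c..e}" if "m \<le> Suc n" for m
    using that
  proof (induction m)
    case (Suc m)
    have "Ck_on m (\<lambda>s. d (X s)) {c..e}"
      by (rule Ck_on_compose[OF assms(2) Ck_on_le[OF assms(4)]]) (use Suc X in force)+
    then have "Ck_on m (\<lambda>s. d (X s) powr (-1)) {c..e}"
      by (rule Ck_on_powr[OF assms(2)]) (use X assms(5) in blast)
    then have "Ck_on m (\<lambda>s. 1 / d (X s)) {c..e}"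
      by (rule Ck_on_transfer[rotated]) (use X assms(5) in \<open>simp add: powr_minus_divide less_imp_le\<close>)
    then show ?case
      by (intro Ck_on_SucI[OF assms(2), where f' = "\<lambda>s. 1 / d (X s)"] der)
  qed (use contX in auto)
  then show "Ck_on (Suc n) X {c..e}" by blast
qed

section \<open>The kernel on the rays\<close>

text \<open>The difference-quotient form suits dominated convergence, and also the derivative of the
  phase coordinate at 0, where the quotient is known explicitly.\<close>

lemma has_vector_derivative_iff_quotient:
  "(f has_vector_derivative D) (at x within S) \<longleftrightarrow>
     ((\<lambda>y. (f y - f x) /\<^sub>R (y - x)) \<longlongrightarrow> D) (at x within S)"
proof -
  have "norm ((f y - f x) - (y - x) *\<^sub>R D) / norm (y - x) = norm ((f y - f x) /\<^sub>R (y - x) - D)"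
    if "y \<noteq> x" for y
  proof -
    have "(f y - f x) - (y - x) *\<^sub>R D = (y - x) *\<^sub>R ((f y - f x) /\<^sub>R (y - x) - D)"
      using that by (simp add: scaleR_diff_right)
    then show ?thesis using that by (simp only: norm_scaleR) simp
  qed
  then have "((\<lambda>y. norm ((f y - f x) - (y - x) *\<^sub>R D) / norm (y - x)) \<longlongrightarrow> 0) (at x within S) \<longleftrightarrow>
      ((\<lambda>y. norm ((f y - f x) /\<^sub>R (y - x) - D)) \<longlongrightarrow> 0) (at x within S)"
    by (intro Lim_cong_within) auto
  then show ?thesis
    unfolding has_vector_derivative_def has_derivative_iff_norm tendsto_norm_zero_iff
    by (simp add: bounded_linear_scaleR_left LIM_zero_iff)
qed

lemma norm_diff_le_vector_derivative:
  assumes "convex S" "\<And>x. x \<in> S \<Longrightarrow> (f has_vector_derivative f' x) (at x within S)"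
    "\<And>x. x \<in> S \<Longrightarrow> norm (f' x) \<le> B" "x \<in> S" "y \<in> S"
  shows "norm (f x - f y) \<le> B * norm (x - y)"
proof (rule differentiable_bound[OF assms(1) _ _ assms(4,5)])
  show "(f has_derivative (\<lambda>h. h *\<^sub>R f' x)) (at x within S)" if "x \<in> S" for x
    using assms(2)[OF that] by (simp add: has_vector_derivative_def)
  show "onorm (\<lambda>h. h *\<^sub>R f' x) \<le> B" if "x \<in> S" for x
    using assms(3)[OF that] by (intro onorm_le) (simp add: mult.commute[of B] mult_left_mono)
qed

text \<open>By the mean value inequality \<open>h\<close> dominates all difference quotients, so
  dominated convergence applies along every sequence tending to \<open>x\<close>. Sequences suffice
  to determine the limit of the quotients.\<close>

lemma has_vector_derivative_integral_dominated:
  fixes f :: "real \<Rightarrow> 'n::euclidean_space \<Rightarrow> 'm::euclidean_space"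
  assumes x: "x \<in> {a<..<b}"
    and int: "\<And>s. s \<in> {a<..<b} \<Longrightarrow> f s integrable_on T"
    and der: "\<And>s t. s \<in> {a<..<b} \<Longrightarrow> t \<in> T \<Longrightarrow> ((\<lambda>s. f s t) has_vector_derivative f' s t) (at s)"
    and bound: "\<And>s t. s \<in> {a<..<b} \<Longrightarrow> t \<in> T \<Longrightarrow> norm (f' s t) \<le> h t"
    and h: "h integrable_on T"
  shows "f' x integrable_on T"
    and "((\<lambda>s. integral T (f s)) has_vector_derivative integral T (f' x)) (at x)"
proof -
  let ?q = "\<lambda>y t. (f y t - f x t) /\<^sub>R (y - x)"
  have conv: "f' x integrable_on T \<and> (\<lambda>k. integral T (?q (X k))) \<longlonglongrightarrow> integral T (f' x)"
    if X: "\<forall>i. X i \<in> {a<..<b} - {x}" "X \<longlonglongrightarrow> x" for X :: "nat \<Rightarrow> real"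
  proof -
    have "?q (X k) integrable_on T" for k
      using X x by (intro integrable_cmul integrable_diff int) auto
    moreover have "norm (?q (X k) t) \<le> h t" if t: "t \<in> T" for k t
    proof -
      have "norm (f (X k) t - f x t) \<le> h t * norm (X k - x)"
      proof (rule norm_diff_le_vector_derivative[of "{a<..<b}"])
        show "((\<lambda>s. f s t) has_vector_derivative f' s t) (at s within {a<..<b})"
          if "s \<in> {a<..<b}" for s
          using der[OF that t] by (rule has_vector_derivative_at_within)
      qed (use bound t X x in auto)
      moreover have "X k \<noteq> x" using X by blast
      ultimately show ?thesis
        by (simp add: divide_inverse[symmetric] mult.commute[of "inverse _"] pos_divide_le_eq)
    qed
    moreover have "(\<lambda>k. ?q (X k) t) \<longlonglongrightarrow> f' x t" if t: "t \<in> T" for t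
    proof -
      have "((\<lambda>y. ?q y t) \<longlongrightarrow> f' x t) (at x)"
        using der[OF x t] by (simp add: has_vector_derivative_iff_quotient)
      moreover have "filterlim X (at x) sequentially"
        using X by (auto simp: filterlim_at)
      ultimately show ?thesis by (rule filterlim_compose)
    qed
    ultimately show ?thesis
      using dominated_convergence[of "\<lambda>k. ?q (X k)" T h "f' x"] h by blast
  qed
  \<comment> \<open>One concrete sequence inside the interval that avoids \<open>x\<close>; applying
    \<open>conv\<close> to it yields the integrability of \<open>f' x\<close>.\<close>
  define X where "X = (\<lambda>k::nat. x + (b - x) / (real k + 2))"
  have X: "\<forall>i. X i \<in> {a<..<b} - {x}" "X \<longlonglongrightarrow> x"
  proof -
    show "\<forall>i. X i \<in> {a<..<b} - {x}"
    proof
      fix i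
      have "0 < (b - x) / (real i + 2)" "(b - x) / (real i + 2) < (b - x) / 1"
        using x by (auto intro!: divide_strict_left_mono divide_pos_pos simp del: div_by_1)
      then show "X i \<in> {a<..<b} - {x}" using x by (auto simp: X_def)
    qed
    show "X \<longlonglongrightarrow> x" unfolding X_def by real_asymp
  qed
  show int': "f' x integrable_on T" using conv[OF X] by blast
  have "((\<lambda>y. integral T (?q y)) \<longlongrightarrow> integral T (f' x)) (at x within {a<..<b})"
    unfolding tendsto_at_iff_sequentially o_def using conv by blast
  moreover have "integral T (?q y) = (integral T (f y) - integral T (f x)) /\<^sub>R (y - x)"
    if "y \<in> {a<..<b}" for y
    using int x that by (simp add: integral_diff)
  then have "((\<lambda>y. integral T (?q y)) \<longlongrightarrow> integral T (f' x)) (at x within {a<..<b}) \<longleftrightarrow>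
      ((\<lambda>y. (integral T (f y) - integral T (f x)) /\<^sub>R (y - x)) \<longlongrightarrow> integral T (f' x)) (at x within {a<..<b})"
    by (intro Lim_cong_within refl)
  ultimately have "((\<lambda>y. (integral T (f y) - integral T (f x)) /\<^sub>R (y - x)) \<longlongrightarrow> integral T (f' x))
      (at x within {a<..<b})"
    by (rule iffD1[rotated])
  then have "((\<lambda>s. integral T (f s)) has_vector_derivative integral T (f' x)) (at x within {a<..<b})"
    by (rule has_vector_derivative_iff_quotient[THEN iffD2])
  then show "((\<lambda>s. integral T (f s)) has_vector_derivative integral T (f' x)) (at x)"
    by (rule has_vector_derivative_within_open[OF x open_greaterThanLessThan, THEN iffD1])
qed

section \<open>Gamma integrals with a power in the exponent\<close>

text \<open>The substitution \<open>u = \<omega> * t powr r\<close> leads to Euler's integral for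
  \<open>Gamma (a / r)\<close>. The point 0 is left out because the substitution need not be
  differentiable there.\<close>

lemma has_integral_power_exp_power:
  fixes a r \<omega> :: real
  assumes "a > 0" "r > 0" "\<omega> > 0"
  shows "((\<lambda>t. t powr (a - 1) * exp (- \<omega> * t powr r)) has_integral
           1 / r * Gamma (a / r) * \<omega> powr (- (a / r))) {0<..}"
proof -
  let ?f = "\<lambda>u::real. u powr (a / r - 1) / exp u"
  let ?g = "\<lambda>t::real. \<omega> * t powr r" and ?g' = "\<lambda>t::real. \<omega> * (r * t powr (r - 1))"
  have img: "?g ` {0<..} = {0<..}"
  proof (intro equalityI subsetI)
    fix u :: real assume "u \<in> {0<..}"
    then have "u = ?g ((u / \<omega>) powr (1 / r))" "(u / \<omega>) powr (1 / r) > 0"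
      using assms by (auto simp: powr_powr)
    then show "u \<in> ?g ` {0<..}" by blast
  qed (use assms in auto)
  have "((\<lambda>t. t powr (a / r - 1) / exp t) has_integral Gamma (a / r)) {0<..}"
    using Gamma_integral_real[of "a / r"] assms
    by (subst has_integral_spike_set_eq[of _ "{0..}"]) (auto intro: negligible_subset[of "{0}"])
  then have "?f absolutely_integrable_on ?g ` {0<..} \<and> integral (?g ` {0<..}) ?f = Gamma (a / r)"
    unfolding img by (auto intro!: nonnegative_absolutely_integrable_1 simp: has_integral_iff)
  moreover have "(?g has_field_derivative ?g' t) (at t within {0<..})" if "t \<in> {0<..}" for t
    using that assms by (auto intro!: derivative_eq_intros simp: powr_diff)
  moreover have "inj_on ?g {0<..}"
    using assms by (intro inj_on_inverseI[of _ "\<lambda>u. (u / \<omega>) powr (1 / r)"]) (simp add: powr_powr)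
  ultimately have *: "((\<lambda>t. \<bar>?g' t\<bar> * ?f (?g t)) has_integral Gamma (a / r)) {0<..}"
    using has_absolute_integral_change_of_variables_1'[of "{0<..}" ?g ?g' ?f "Gamma (a / r)"]
    by (auto simp: has_integral_iff dest: set_lebesgue_integral_eq_integral(1))
  have "\<bar>?g' t\<bar> * ?f (?g t) = (r * \<omega> powr (a / r)) * (t powr (a - 1) * exp (- \<omega> * t powr r))"
    if "t \<in> {0<..}" for t
  proof -
    have "t powr (r - 1) * (\<omega> * t powr r) powr (a / r - 1) =
        \<omega> powr (a / r - 1) * t powr (r - 1 + r * (a / r - 1))"
      using that assms by (simp add: powr_mult powr_powr powr_add)
    also have "r - 1 + r * (a / r - 1) = a - 1"
      using assms by (simp add: field_simps)
    finally have "t powr (r - 1) * (\<omega> * t powr r) powr (a / r - 1) = \<omega> powr (a / r) / \<omega> * t powr (a - 1)"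
      using assms by (simp add: powr_diff)
    then show ?thesis
      using that assms by (simp add: exp_minus field_simps abs_mult)
  qed
  from has_integral_eq[OF this *]
  have "((\<lambda>t. (r * \<omega> powr (a / r)) * (t powr (a - 1) * exp (- \<omega> * t powr r))) has_integral Gamma (a / r)) {0<..}" .
  from has_integral_mult_right[OF this, of "1 / (r * \<omega> powr (a / r))"] show ?thesis
    using assms by (simp add: powr_minus field_simps)
qed

section \<open>Geometry of the rays and principal powers along them\<close>

lemma minus_one_power_cases:
  "(-1 :: 'a::ring_1) ^ n = 1 \<or> (-1 :: 'a) ^ n = -1"
  by (cases "even n") auto

lemma ray_dir_cis: "ray_dir j r = cis ((-1) ^ (j + 1) * (pi / (2 * r)))"
  by (simp add: ray_dir_def cis_conv_exp algebra_simps)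

lemma norm_ray_dir [simp]: "norm (ray_dir j r) = 1"
  by (simp add: ray_dir_cis)

lemma ray_dir_nonzero [simp]: "ray_dir j r \<noteq> 0"
  by (metis norm_ray_dir norm_zero zero_neq_one)

text \<open>Here \<open>r \<ge> 1\<close> enters: the angle of the ray with the real axis is at most
  a right angle, which fixes the signs needed for \<open>ray_dir\<close>.\<close>

lemma pi_half_div_bounds:
  fixes r :: real
  assumes "r \<ge> 1"
  shows "0 < pi / (2 * r)" "pi / (2 * r) \<le> pi / 2" "- (pi / (2 * r)) \<le> pi / 2"
    "- (pi / 2) \<le> pi / (2 * r)"
proof -
  show "0 < pi / (2 * r)" "pi / (2 * r) \<le> pi / 2"
    using assms by (auto simp: field_simps)
  then show "- (pi / (2 * r)) \<le> pi / 2" "- (pi / 2) \<le> pi / (2 * r)"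
    using pi_gt_zero by linarith+
qed

lemma Re_ray_dir: "r \<ge> 1 \<Longrightarrow> Re (ray_dir j r) \<ge> 0"
  using pi_half_div_bounds[of r] cos_ge_zero[of "pi / (2 * r)"] minus_one_power_cases[of "j + 1", where ?'a = real]
  by (auto simp only: ray_dir_cis cis.sel) simp_all

lemma Im_ray_dir: "r \<ge> 1 \<Longrightarrow> Im (ray_dir j r) \<noteq> 0"
  using pi_half_div_bounds[of r] sin_gt_zero[of "pi / (2 * r)"] pi_gt_zero
    minus_one_power_cases[of "j + 1", where ?'a = real]
  by (auto simp only: ray_dir_cis cis.sel) simp_all

text \<open>The exponent \<open>?w\<close> has imaginary part strictly between \<open>-pi\<close>
  and \<open>pi\<close>, so the principal logarithm returns it without a jump.\<close>

lemma powr_ray_dir: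
  assumes "r \<ge> 1" "t > 0"
  shows "(of_real t * ray_dir j r) powr of_real a =
    of_real (t powr a) * exp ((-1) ^ (j + 1) * \<i> * of_real (pi / 2 * (a / r)))"
proof -
  let ?w = "of_real (ln t) + (-1) ^ (j + 1) * \<i> * of_real (pi / (2 * r)) :: complex"
  have "Im ?w = pi / (2 * r) \<or> Im ?w = - (pi / (2 * r))"
    by (cases "even j") auto
  then have "Ln (exp ?w) = ?w"
    using pi_half_div_bounds[OF assms(1)] pi_gt_zero by (intro Ln_exp) linarith+
  moreover have "exp ?w = of_real t * ray_dir j r"
    unfolding exp_add ray_dir_def using assms by (simp add: exp_of_real)
  ultimately have "Ln (of_real t * ray_dir j r) = ?w" by simp
  then have "(of_real t * ray_dir j r) powr of_real a = exp (of_real a * ?w)"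
    using assms by (simp add: powr_def)
  also have "of_real a * ?w = of_real (a * ln t) + (-1) ^ (j + 1) * \<i> * of_real (pi / 2 * (a / r))"
    by (simp add: algebra_simps)
  also have "exp \<dots> = of_real (t powr a) * exp ((-1) ^ (j + 1) * \<i> * of_real (pi / 2 * (a / r)))"
    unfolding exp_add exp_of_real using assms by (simp add: powr_def)
  finally show ?thesis .
qed

definition ray_pt :: "nat \<Rightarrow> real \<Rightarrow> real \<Rightarrow> real \<Rightarrow> complex" where
  "ray_pt j r s t = of_real s + of_real t * ray_dir j r"

text \<open>Since \<open>ray_dir\<close> has nonnegative real part, the real part of the point is at
  least \<open>s\<close>, and the mixed term in the expansion of its squared norm is
  nonnegative.\<close>

lemma ray_pt_bounds:
  assumes "r \<ge> 1" "s \<ge> 0" "t \<ge> 0"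
  shows "s \<le> norm (ray_pt j r s t)" "t \<le> norm (ray_pt j r s t)" "norm (ray_pt j r s t) \<le> s + t"
proof -
  let ?z = "ray_dir j r"
  have "s \<le> Re (ray_pt j r s t)"
    using Re_ray_dir[of r j] assms by (simp add: ray_pt_def)
  then show "s \<le> norm (ray_pt j r s t)"
    using complex_Re_le_cmod order_trans by blast
  have "(Re ?z)\<^sup>2 + (Im ?z)\<^sup>2 = 1"
    using norm_ray_dir[of j r] by (metis cmod_power2 one_power2)
  then have "(norm (ray_pt j r s t))\<^sup>2 = s\<^sup>2 + 2 * s * t * Re ?z + t\<^sup>2"
    unfolding cmod_power2 ray_pt_def by (simp add: power2_eq_square) algebra
  moreover have "0 \<le> s * t * Re ?z"
    using Re_ray_dir[of r j] assms by simp
  ultimately have "t\<^sup>2 \<le> (norm (ray_pt j r s t))\<^sup>2" by simp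
  then show "t \<le> norm (ray_pt j r s t)"
    by (rule power2_le_imp_le) simp
  show "norm (ray_pt j r s t) \<le> s + t"
    using norm_triangle_ineq[of "of_real s" "of_real t * ?z"] assms by (simp add: ray_pt_def norm_mult)
qed

lemma ray_pt_not_nonpos:
  assumes "r \<ge> 1" "s \<ge> 0" "t \<ge> 0" "s > 0 \<or> t > 0"
  shows "ray_pt j r s t \<notin> \<real>\<^sub>\<le>\<^sub>0"
proof (cases "t > 0")
  case True
  then show ?thesis
    using Im_ray_dir[OF assms(1)] by (auto simp: ray_pt_def complex_nonpos_Reals_iff)
next
  case False
  then show ?thesis
    using assms by (auto simp: ray_pt_def complex_nonpos_Reals_iff)
qed

text \<open>Along the horizontal segment from \<open>t e\<^sup>i\<^sup>\<theta>\<close> to \<open>s + t e\<^sup>i\<^sup>\<theta>\<close> the imaginary part of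
  \<open>z\<^sup>r\<close> increases, because its derivative \<open>r Im z\<^sup>r\<^sup>-\<^sup>1\<close> is nonnegative in the sector
  \<open>0 \<le> arg z \<le> \<theta>\<close>.\<close>

lemma Im_powr_sector:
  fixes r s t :: real
  assumes "r \<ge> 1" "s \<ge> 0" "t > 0"
  defines "\<theta> \<equiv> pi / (2 * r)"
  shows "t powr r \<le> Im ((of_real s + of_real t * cis \<theta>) powr of_real r)"
proof -
  define z :: "complex \<Rightarrow> complex" where "z = (\<lambda>u. u + of_real t * cis \<theta>)"
  have \<theta>: "0 < \<theta>" "\<theta> \<le> pi / 2" using pi_half_div_bounds[OF assms(1)] by (auto simp: \<theta>_def)
  have sin: "sin \<theta> > 0" using \<theta> pi_gt_zero by (intro sin_gt_zero) linarith+
  have cos: "cos \<theta> \<ge> 0" using \<theta> by (intro cos_ge_zero) auto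
  have z_pos: "Im (z (of_real u)) > 0" "Re (z (of_real u)) \<ge> 0" if "u \<ge> 0" for u
    using that sin cos assms by (auto simp: z_def)
  have "\<exists>y. DERIV (\<lambda>u. Im (z (of_real u) powr of_real r)) u :> y \<and> y \<ge> 0" if "0 \<le> u" "u \<le> s" for u
  proof (intro exI conjI)
    note zu = z_pos[OF that(1)]
    let ?\<alpha> = "Im (Ln (z (of_real u)))"
    have nz: "z (of_real u) \<noteq> 0" using zu by (metis less_irrefl zero_complex.sel(2))
    have "((\<lambda>w. z w powr of_real r) has_field_derivative of_real r * z (of_real u) powr (of_real r - 1)) (at (of_real u))"
      unfolding z_def using zu
      by (auto intro!: derivative_eq_intros simp: complex_nonpos_Reals_iff z_def)
    then have "((\<lambda>u. z (of_real u) powr of_real r) has_vector_derivative of_real r * z (of_real u) powr (of_real r - 1)) (at u)"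
      by (rule has_vector_derivative_real_field)
    from bounded_linear.has_vector_derivative[OF bounded_linear_Im this]
    show "DERIV (\<lambda>u. Im (z (of_real u) powr of_real r)) u :> Im (of_real r * z (of_real u) powr (of_real r - 1))"
      by (simp add: has_real_derivative_iff_has_vector_derivative)
    have \<alpha>: "0 \<le> ?\<alpha>" "?\<alpha> \<le> pi / 2"
      using Im_Ln_pos_le[OF nz] Re_Ln_pos_le[OF nz] zu by auto
    \<comment> \<open>Rotating the point by \<open>-\<theta>\<close> gives imaginary part
      \<open>- u * sin \<theta>\<close>, which is not positive; an argument above
      \<open>\<theta>\<close> would make it positive.\<close>
    have "?\<alpha> \<le> \<theta>"
    proof (rule ccontr)
      assume "\<not> ?\<alpha> \<le> \<theta>"
      then have "0 < sin (?\<alpha> - \<theta>)"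
        using \<theta> \<alpha> pi_gt_zero by (intro sin_gt_zero) linarith+
      moreover have "Im (z (of_real u) * cis (- \<theta>)) = norm (z (of_real u)) * sin (?\<alpha> - \<theta>)"
      proof -
        have "z (of_real u) = exp (Ln (z (of_real u)))" using nz by simp
        also have "\<dots> = of_real (norm (z (of_real u))) * cis ?\<alpha>"
          using nz by (simp add: exp_eq_polar)
        finally have "z (of_real u) * cis (- \<theta>) = of_real (norm (z (of_real u))) * cis (?\<alpha> - \<theta>)"
          by (metis (no_types) cis_mult diff_conv_add_uminus mult.assoc)
        then show ?thesis by simp
      qed
      moreover have "Im (z (of_real u) * cis (- \<theta>)) = - u * sin \<theta>"
        by (simp add: z_def algebra_simps)
      moreover have "norm (z (of_real u)) > 0" using nz by simp
      moreover have "u * sin \<theta> \<ge> 0" using sin that by simp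
      ultimately show False
        by (smt (verit) mult_minus_left mult_pos_pos)
    qed
    then have "(r - 1) * ?\<alpha> \<le> (r - 1) * \<theta>" using assms by (intro mult_left_mono) auto
    also have "\<dots> \<le> pi" using assms by (simp add: \<theta>_def field_simps)
    finally have "sin ((r - 1) * ?\<alpha>) \<ge> 0"
      using \<alpha> assms by (intro sin_ge_zero) auto
    then show "0 \<le> Im (of_real r * z (of_real u) powr (of_real r - 1))"
      using nz assms by (simp add: powr_def Im_exp)
  qed
  then have "Im (z (of_real 0) powr of_real r) \<le> Im (z (of_real s) powr of_real r)"
    by (intro DERIV_nonneg_imp_nondecreasing[OF assms(2)])
  \<comment> \<open>Starting value: on the ray from the origin the power turns the angle
    \<open>\<theta>\<close> into \<open>pi / 2\<close>.\<close>
  moreover have "z (of_real 0) powr of_real r = of_real (t powr r) * \<i>"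
    using powr_ray_dir[of r t 1 r] assms by (simp add: z_def ray_dir_cis exp_eq_polar cis.ctr complex_eq_iff)
  ultimately show ?thesis by (simp add: z_def)
qed

text \<open>Odd \<open>j\<close> is the sector estimate itself. For even \<open>j\<close> the ray is
  the complex conjugate one, and conjugation commutes with the principal power off the real
  axis.\<close>

lemma ray_phase_decay:
  assumes "r \<ge> 1" "s \<ge> 0" "t > 0"
  shows "Re ((-1) ^ (j + 1) * \<i> * ray_pt j r s t powr of_real r) \<le> - (t powr r)"
proof (cases "even j")
  case False
  then show ?thesis
    using Im_powr_sector[OF assms] by (simp add: ray_pt_def ray_dir_cis)
next
  case True
  let ?z = "of_real s + of_real t * cis (pi / (2 * r))"
  have z: "ray_pt j r s t = cnj ?z"
    using True by (simp add: ray_pt_def ray_dir_cis cis_cnj)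
  have "Im ?z = t * sin (pi / (2 * r))" by simp
  then have "Im ?z \<noteq> 0"
    using Im_ray_dir[OF assms(1), of 1] assms by (simp add: ray_dir_cis)
  then have "cnj ?z powr of_real r = cnj (?z powr of_real r)"
    by (subst cnj_powr) auto
  then show ?thesis
    unfolding z using True Im_powr_sector[OF assms] by simp
qed

section \<open>Kernel integrals along a ray\<close>

text \<open>The fundamental theorem on \<open>{a..a + real k}\<close> is followed by dominated
  convergence of the truncations. At \<open>a\<close> itself only continuity of \<open>F\<close>
  enters.\<close>

lemma has_integral_Ioi_FTC:
  fixes F :: "real \<Rightarrow> 'a::euclidean_space"
  assumes cont: "continuous_on {a..} F"
    and der: "\<And>t. t > a \<Longrightarrow> (F has_vector_derivative f t) (at t)"
    and int: "f absolutely_integrable_on {a<..}" and lim: "(F \<longlongrightarrow> 0) at_top"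
  shows "(f has_integral - F a) {a<..}"
proof -
  have "(f has_integral F (a + real k) - F a) {a..a + real k}" for k
    by (rule fundamental_theorem_of_calculus_interior)
      (use der in \<open>auto intro: continuous_on_subset[OF cont]\<close>)
  then have "integral {a..a + real k} f = F (a + real k) - F a" for k
    by (simp add: integral_unique)
  moreover have "(\<lambda>k. F (a + real k) - F a) \<longlonglongrightarrow> 0 - F a"
    by (intro tendsto_intros filterlim_compose[OF lim]) real_asymp
  moreover have "(\<lambda>k. integral {a..a + real k} f) \<longlonglongrightarrow> integral {a<..} f"
  proof -
    let ?f = "\<lambda>k t. if t \<in> {a<..a + real k} then f t else 0"
    have f: "(?f k has_integral integral {a..a + real k} f) {a<..}" for k
    proof -
      have "(f has_integral integral {a..a + real k} f) {a..a + real k}"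
        using \<open>\<And>k. (f has_integral F (a + real k) - F a) {a..a + real k}\<close>[of k] by (simp add: has_integral_iff)
      then have "(f has_integral integral {a..a + real k} f) {a<..a + real k}"
        by (subst has_integral_spike_set_eq[of _ "{a..a + real k}"]) (auto intro: negligible_subset[of "{a}"])
      then show ?thesis by (subst has_integral_restrict) auto
    qed
    have "(\<lambda>k. integral {a<..} (?f k)) \<longlonglongrightarrow> integral {a<..} f"
    proof (rule dominated_convergence(2))
      show "(\<lambda>t. norm (f t)) integrable_on {a<..}"
        using int by (simp add: absolutely_integrable_on_def)
      show "(\<lambda>k. ?f k t) \<longlonglongrightarrow> f t" if "t \<in> {a<..}" for t
      proof (rule tendsto_eventually)
        have "\<forall>\<^sub>F k in sequentially. t - a \<le> real k" by real_asymp
        then show "\<forall>\<^sub>F k in sequentially. ?f k t = f t"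
          by eventually_elim (use that in auto)
      qed
    qed (use f in \<open>auto simp: integrable_on_def\<close>)
    then show ?thesis by (simp only: integral_unique[OF f])
  qed
  ultimately have "integral {a<..} f = - F a"
    using LIMSEQ_unique by fastforce
  then show ?thesis
    using int set_lebesgue_integral_eq_integral(1) by (auto simp: has_integral_iff)
qed

text \<open>At positive real \<open>z\<close> this is the singular oscillating weight against which
  the transformed amplitude is integrated; on the rays it is the integrand of \<open>phi_fun\<close>
  without the factor \<open>(z - s) ^ n\<close>.\<close>

definition osc :: "nat \<Rightarrow> real \<Rightarrow> real \<Rightarrow> real \<Rightarrow> complex \<Rightarrow> complex" where
  "osc j \<omega> r m z =
     z powr of_real (m - 1) * exp ((-1) ^ (j + 1) * \<i> * of_real \<omega> * z powr of_real r)"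

text \<open>The integrand of \<open>phi_fun j (Suc n)\<close> in the ray parameter: there
  \<open>z - s\<close> is \<open>t\<close> times \<open>ray_dir\<close>, and the last factor is
  \<open>dz/dt\<close>.\<close>

definition ray_osc :: "nat \<Rightarrow> real \<Rightarrow> real \<Rightarrow> real \<Rightarrow> nat \<Rightarrow> real \<Rightarrow> real \<Rightarrow> complex" where
  "ray_osc j \<omega> r m n s t =
     (of_real t * ray_dir j r) ^ n * osc j \<omega> r m (ray_pt j r s t) * ray_dir j r"

lemma integral_Ici_eq_Ioi:
  fixes f :: "real \<Rightarrow> 'a::banach"
  shows "integral {a..} f = integral {a<..} f"
  by (rule integral_spike_set; rule negligible_subset[of "{a}"]) auto

lemma phi_fun_Suc:
  "phi_fun j (Suc n) s \<omega> r m =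
     (-1) ^ (n + 1) / of_real (fact n) * integral {0<..} (ray_osc j \<omega> r m n s)"
  by (simp add: ray_integral_def integral_Ici_eq_Ioi ray_osc_def[abs_def] osc_def ray_pt_def mult.assoc)

declare phi_fun.simps [simp del]

locale osc_kernel =
  fixes j :: nat and \<omega> r m :: real
  assumes \<omega>: "\<omega> > 0" and r: "r \<ge> 1" and m: "0 < m" "m < 1"
begin

lemma norm_osc_ray:
  assumes "s \<ge> 0" "t > 0"
  shows "norm (osc j \<omega> r m (ray_pt j r s t)) \<le> norm (ray_pt j r s t) powr (m - 1) * exp (- \<omega> * t powr r)"
proof -
  let ?z = "ray_pt j r s t"
  have "Re ((-1) ^ (j + 1) * \<i> * of_real \<omega> * ?z powr of_real r) =
      \<omega> * Re ((-1) ^ (j + 1) * \<i> * ?z powr of_real r)"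
    by (cases "even j") auto
  also have "\<dots> \<le> \<omega> * (- (t powr r))"
    using ray_phase_decay[OF r assms] \<omega> by (intro mult_left_mono) auto
  finally show ?thesis
    unfolding osc_def norm_mult norm_exp_eq_Re
    by (intro mult_mono) (auto simp: norm_powr_real_powr')
qed

text \<open>Because \<open>m - 1\<close> is negative, the bounds \<open>t\<close> and
  \<open>s\<close> from below for the modulus give two estimates. The first is uniform in
  \<open>s\<close> and gives integrability and continuity down to \<open>s = 0\<close>; the second
  produces the weight \<open>s powr (m - 1)\<close> of the remainder estimate.\<close>

lemma norm_ray_osc:
  assumes "s \<ge> 0" "t > 0"
  shows "norm (ray_osc j \<omega> r m n s t) \<le> t powr (real n + m - 1) * exp (- \<omega> * t powr r)"
    and "s > 0 \<Longrightarrow> norm (ray_osc j \<omega> r m n s t) \<le> s powr (m - 1) * (t ^ n * exp (- \<omega> * t powr r))"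
proof -
  let ?z = "ray_pt j r s t"
  have eq: "norm (ray_osc j \<omega> r m n s t) = t ^ n * norm (osc j \<omega> r m ?z)"
    using assms by (simp add: ray_osc_def norm_mult norm_power)
  have le: "norm (ray_osc j \<omega> r m n s t) \<le> t ^ n * (c powr (m - 1) * exp (- \<omega> * t powr r))"
    if c: "0 < c" "c \<le> norm ?z" for c
  proof -
    have "norm ?z powr (m - 1) \<le> c powr (m - 1)"
      using c m by (intro powr_mono2') auto
    then have "norm (osc j \<omega> r m ?z) \<le> c powr (m - 1) * exp (- \<omega> * t powr r)"
      using norm_osc_ray[OF assms] by (meson exp_ge_zero mult_right_mono order_trans)
    then show ?thesis unfolding eq using assms by (intro mult_left_mono) auto
  qed
  have "t ^ n * t powr (m - 1) = t powr (real n + m - 1)"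
    using assms by (simp add: powr_realpow[symmetric] powr_add[symmetric] add_diff_eq)
  then show "norm (ray_osc j \<omega> r m n s t) \<le> t powr (real n + m - 1) * exp (- \<omega> * t powr r)"
    using le[of t] ray_pt_bounds(2)[OF r, of s t] assms by (simp add: mult.assoc[symmetric])
  show "norm (ray_osc j \<omega> r m n s t) \<le> s powr (m - 1) * (t ^ n * exp (- \<omega> * t powr r))" if "s > 0"
    using le[of s] ray_pt_bounds(1)[OF r, of s t] assms that by (simp add: mult_ac)
qed

lemma has_integral_dominant:
  assumes "a > 0"
  shows "((\<lambda>t. t powr (a - 1) * exp (- \<omega> * t powr r)) has_integral
           1 / r * Gamma (a / r) * \<omega> powr (- (a / r))) {0<..}"
  using has_integral_power_exp_power[of a r \<omega>] assms \<omega> r by simp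

lemma continuous_on_osc: "continuous_on (- \<real>\<^sub>\<le>\<^sub>0) (osc j \<omega> r m)"
  unfolding osc_def by (intro continuous_intros) (auto simp: complex_nonpos_Reals_iff)

lemma continuous_on_ray_osc:
  assumes "s \<ge> 0"
  shows "continuous_on {0<..} (ray_osc j \<omega> r m n s)"
  unfolding ray_osc_def
  by (intro continuous_intros continuous_on_compose2[OF continuous_on_osc])
    (use ray_pt_not_nonpos[OF r] assms in \<open>auto simp: ray_pt_def intro!: continuous_intros\<close>)

lemma ray_osc_integrable:
  assumes "s \<ge> 0"
  shows "ray_osc j \<omega> r m n s integrable_on {0<..}"
proof (rule measurable_bounded_by_integrable_imp_integrable)
  show "ray_osc j \<omega> r m n s \<in> borel_measurable (lebesgue_on {0<..})"
    using continuous_on_ray_osc[OF assms] by (rule continuous_imp_measurable_on_sets_lebesgue) auto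
  show "(\<lambda>t. t powr (real n + m - 1) * exp (- \<omega> * t powr r)) integrable_on {0<..}"
    using has_integral_dominant[of "real n + m"] m by (auto simp: integrable_on_def)
qed (use norm_ray_osc(1) assms in auto)

lemma ray_osc_absolutely_integrable:
  assumes "s \<ge> 0"
  shows "ray_osc j \<omega> r m n s absolutely_integrable_on {0<..}"
  using has_integral_dominant[of "real n + m"] m norm_ray_osc(1)[OF assms] ray_osc_integrable[OF assms]
  by (intro absolutely_integrable_integrable_bound[where g = "\<lambda>t. t powr (real n + m - 1) * exp (- \<omega> * t powr r)"])
    (auto simp: integrable_on_def)

text \<open>The dominating function does not depend on \<open>s\<close>, so continuity reaches
  \<open>s = 0\<close>, whereas the derivative is computed for \<open>s > 0\<close> only.\<close>

lemma continuous_on_integral_ray_osc: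
  "continuous_on {0..} (\<lambda>s. integral {0<..} (ray_osc j \<omega> r m n s))"
  unfolding continuous_on_sequentially o_def
proof safe
  fix X :: "nat \<Rightarrow> real" and s :: real
  assume X: "\<forall>k. X k \<in> {0..}" "X \<longlonglongrightarrow> s" and s: "0 \<le> s"
  show "(\<lambda>k. integral {0<..} (ray_osc j \<omega> r m n (X k))) \<longlonglongrightarrow> integral {0<..} (ray_osc j \<omega> r m n s)"
  proof (rule dominated_convergence(2))
    show "(\<lambda>t. t powr (real n + m - 1) * exp (- \<omega> * t powr r)) integrable_on {0<..}"
      using has_integral_dominant[of "real n + m"] m by (auto simp: integrable_on_def)
    show "(\<lambda>k. ray_osc j \<omega> r m n (X k) t) \<longlonglongrightarrow> ray_osc j \<omega> r m n s t" if t: "t \<in> {0<..}" for t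
    proof -
      have "(\<lambda>k. ray_pt j r (X k) t) \<longlonglongrightarrow> ray_pt j r s t"
        unfolding ray_pt_def by (intro tendsto_intros X)
      moreover have "isCont (osc j \<omega> r m) (ray_pt j r s t)"
        using continuous_on_osc ray_pt_not_nonpos[OF r s, of t] t
        by (subst (asm) continuous_on_eq_continuous_at) auto
      ultimately have "(\<lambda>k. osc j \<omega> r m (ray_pt j r (X k) t)) \<longlonglongrightarrow> osc j \<omega> r m (ray_pt j r s t)"
        by (rule isCont_tendsto_compose[rotated])
      then show ?thesis unfolding ray_osc_def by (intro tendsto_intros)
    qed
  qed (use X ray_osc_integrable norm_ray_osc(1) in auto)
qed

section \<open>The kernel integrals as functions of their starting point\<close>

text \<open>The complex derivative of \<open>osc\<close>. The powers with exponents
  \<open>m - 1\<close> and \<open>r - 1\<close> are kept apart because one decreases and the other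
  does not decrease in the modulus.\<close>

definition osc' :: "complex \<Rightarrow> complex" where
  "osc' z = (of_real (m - 1) * z powr of_real (m - 2) +
      (-1) ^ (j + 1) * \<i> * of_real (\<omega> * r) * z powr of_real (m - 1) * z powr of_real (r - 1)) *
     exp ((-1) ^ (j + 1) * \<i> * of_real \<omega> * z powr of_real r)"

lemma osc_has_field_derivative:
  assumes "z \<notin> \<real>\<^sub>\<le>\<^sub>0"
  shows "(osc j \<omega> r m has_field_derivative osc' z) (at z)"
  unfolding osc_def[abs_def] osc'_def using assms
  by (auto intro!: derivative_eq_intros simp: algebra_simps)

text \<open>The modulus lies between \<open>s\<close> and \<open>s + t\<close>. Negative exponents
  are estimated at \<open>s\<close>; the exponent \<open>r - 1\<close> is estimated at
  \<open>2 * max s t\<close>, and the maximum is replaced by a sum.\<close>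

lemma norm_osc':
  assumes "s > 0" "t > 0"
  shows "norm (osc' (ray_pt j r s t)) \<le>
    (s powr (m - 2) + \<omega> * r * s powr (m - 1) * ((2 * s) powr (r - 1) + (2 * t) powr (r - 1))) * exp (- \<omega> * t powr r)"
proof -
  let ?z = "ray_pt j r s t"
  have z: "s \<le> norm ?z" "norm ?z \<le> s + t" using ray_pt_bounds[OF r, of s t] assms by auto
  have "norm ?z powr (r - 1) \<le> (2 * max s t) powr (r - 1)"
    using z r assms by (intro powr_mono2) auto
  also have "\<dots> \<le> (2 * s) powr (r - 1) + (2 * t) powr (r - 1)"
    by (auto simp: max_def)
  finally have 1: "norm ?z powr (r - 1) \<le> (2 * s) powr (r - 1) + (2 * t) powr (r - 1)" .
  have 2: "norm ?z powr (m - 1) \<le> s powr (m - 1)" "norm ?z powr (m - 2) \<le> s powr (m - 2)"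
    using z assms m by (auto intro!: powr_mono2')
  have "norm (exp ((-1) ^ (j + 1) * \<i> * of_real \<omega> * ?z powr of_real r)) \<le> exp (- \<omega> * t powr r)"
  proof -
    have "Re ((-1) ^ (j + 1) * \<i> * of_real \<omega> * ?z powr of_real r) =
        \<omega> * Re ((-1) ^ (j + 1) * \<i> * ?z powr of_real r)"
      by (cases "even j") auto
    also have "\<dots> \<le> \<omega> * (- (t powr r))"
      using ray_phase_decay[OF r, of s t j] assms \<omega> by (intro mult_left_mono) auto
    finally show ?thesis by (simp add: norm_exp_eq_Re)
  qed
  moreover have "norm (of_real (m - 1) * ?z powr of_real (m - 2) +
      (-1) ^ (j + 1) * \<i> * of_real (\<omega> * r) * ?z powr of_real (m - 1) * ?z powr of_real (r - 1)) \<le>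
     1 * s powr (m - 2) + \<omega> * r * s powr (m - 1) * ((2 * s) powr (r - 1) + (2 * t) powr (r - 1))"
  proof (intro norm_triangle_mono)
    show "norm (of_real (m - 1) * ?z powr of_real (m - 2)) \<le> 1 * s powr (m - 2)"
      unfolding norm_mult norm_of_real using m 2 by (intro mult_mono) (auto simp: norm_powr_real_powr')
    show "norm ((-1) ^ (j + 1) * \<i> * of_real (\<omega> * r) * ?z powr of_real (m - 1) * ?z powr of_real (r - 1)) \<le>
      \<omega> * r * s powr (m - 1) * ((2 * s) powr (r - 1) + (2 * t) powr (r - 1))"
    proof -
      have "norm ((-1) ^ (j + 1) * \<i> * of_real (\<omega> * r) * ?z powr of_real (m - 1) * ?z powr of_real (r - 1)) =
          \<omega> * r * norm ?z powr (m - 1) * norm ?z powr (r - 1)"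
        using \<omega> r by (simp add: norm_mult norm_power norm_powr_real_powr' del: of_real_diff of_real_mult)
      also have "\<dots> \<le> \<omega> * r * s powr (m - 1) * ((2 * s) powr (r - 1) + (2 * t) powr (r - 1))"
        using \<omega> r by (intro mult_mono[OF mult_left_mono[OF 2(1)] 1]) auto
      finally show ?thesis .
    qed
  qed
  ultimately show ?thesis
    unfolding osc'_def norm_mult using \<omega> r by (intro mult_mono) auto
qed


text \<open>This replaces the contour deformation: up to the term from differentiating the power of
  \<open>t\<close>, the integrand is the \<open>t\<close>-derivative of \<open>?H\<close>, which
  tends to 0 at infinity. At \<open>t = 0\<close> the boundary value of \<open>?H\<close> survives
  only for \<open>n = 0\<close>, where it is \<open>osc\<close> at \<open>s\<close>.\<close>

lemma integral_osc'_IBP: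
  assumes s: "s > 0"
    and int: "(\<lambda>t. (of_real t * ray_dir j r) ^ n * osc' (ray_pt j r s t) * ray_dir j r) absolutely_integrable_on {0<..}"
  shows "integral {0<..} (\<lambda>t. (of_real t * ray_dir j r) ^ n * osc' (ray_pt j r s t) * ray_dir j r) =
    (case n of 0 \<Rightarrow> - osc j \<omega> r m (of_real s)
       | Suc k \<Rightarrow> - of_nat n * integral {0<..} (ray_osc j \<omega> r m k s))"
proof -
  let ?\<zeta> = "ray_dir j r"
  let ?H = "\<lambda>t. (of_real t * ?\<zeta>) ^ n * osc j \<omega> r m (ray_pt j r s t)"
  let ?D = "\<lambda>t. (of_real t * ?\<zeta>) ^ n * osc' (ray_pt j r s t) * ?\<zeta>"
  \<comment> \<open>The contribution of the derivative of the \<open>n\<close>-th power; for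
    \<open>n = 0\<close> there is none.\<close>
  let ?E = "\<lambda>t. case n of 0 \<Rightarrow> 0 | Suc k \<Rightarrow> of_nat n * ray_osc j \<omega> r m k s t"
  have intE: "?E absolutely_integrable_on {0<..}"
    using ray_osc_absolutely_integrable[of s] s by (cases n) (auto intro!: set_integrable_mult_right)
  have "((\<lambda>t. ?D t + ?E t) has_integral - ?H 0) {0<..}"
  proof (rule has_integral_Ioi_FTC)
    show "continuous_on {0..} ?H"
      by (intro continuous_intros continuous_on_compose2[OF continuous_on_osc])
        (use ray_pt_not_nonpos[OF r] s in \<open>auto simp: ray_pt_def intro!: continuous_intros\<close>)
    show "(?H has_vector_derivative ?D t + ?E t) (at t)" if t: "t > 0" for t
    proof -
      have z: "of_real s + of_real t * ?\<zeta> \<notin> \<real>\<^sub>\<le>\<^sub>0"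
        using ray_pt_not_nonpos[OF r, of s t j] s t by (simp add: ray_pt_def)
      have O: "((\<lambda>w. osc j \<omega> r m (of_real s + w * ?\<zeta>)) has_field_derivative
          osc' (of_real s + of_real t * ?\<zeta>) * ?\<zeta>) (at (of_real t))"
        by (rule DERIV_chain2[where f = "osc j \<omega> r m" and g = "\<lambda>w. of_real s + w * ?\<zeta>" and x = "of_real t"])
          (auto intro!: derivative_eq_intros osc_has_field_derivative z)
      have P: "((\<lambda>w. (w * ?\<zeta>) ^ n) has_field_derivative
          of_nat n * (of_real t * ?\<zeta>) ^ (n - 1) * ?\<zeta>) (at (of_real t))"
        by (auto intro!: derivative_eq_intros)
      have E: "of_nat n * (of_real t * ?\<zeta>) ^ (n - 1) * ?\<zeta> * osc j \<omega> r m (of_real s + of_real t * ?\<zeta>) = ?E t"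
        by (cases n) (simp_all add: ray_pt_def ray_osc_def)
      have "((\<lambda>w. (w * ?\<zeta>) ^ n * osc j \<omega> r m (of_real s + w * ?\<zeta>)) has_field_derivative ?D t + ?E t) (at (of_real t))"
        by (rule DERIV_cong[OF DERIV_mult[OF P O]], unfold E) (simp add: ray_pt_def)
      then show ?thesis
        unfolding ray_pt_def by (rule has_vector_derivative_real_field)
    qed
    show "(\<lambda>t. ?D t + ?E t) absolutely_integrable_on {0<..}"
      using int intE by (rule set_integral_add(1))
    have "(?H \<longlongrightarrow> 0) at_top"
    proof (rule Lim_null_comparison)
      show "\<forall>\<^sub>F t in at_top. norm (?H t) \<le> s powr (m - 1) * (t ^ n * exp (- \<omega> * t powr r))"
        using eventually_gt_at_top[of 0]
      proof eventually_elim
        case (elim t)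
        then show ?case
          using norm_ray_osc(2)[of s t n] s by (simp add: ray_osc_def norm_mult)
      qed
      show "((\<lambda>t. s powr (m - 1) * (t ^ n * exp (- \<omega> * t powr r))) \<longlongrightarrow> 0) at_top"
        using \<omega> r by real_asymp
    qed
    then show "(?H \<longlongrightarrow> 0) at_top" .
  qed
  then have "integral {0<..} (\<lambda>t. ?D t + ?E t) = - ?H 0"
    by (rule integral_unique)
  moreover have "integral {0<..} (\<lambda>t. ?D t + ?E t) = integral {0<..} ?D + integral {0<..} ?E"
    using int intE by (intro integral_add set_lebesgue_integral_eq_integral(1))
  ultimately have *: "integral {0<..} ?D = - ?H 0 - integral {0<..} ?E"
    by (simp add: eq_diff_eq)
  show ?thesis
    unfolding * by (cases n) (simp_all add: ray_pt_def del: of_nat_Suc)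
qed

lemma integral_ray_osc_has_vector_derivative:
  assumes s: "s > 0"
  shows "((\<lambda>s. integral {0<..} (ray_osc j \<omega> r m n s)) has_vector_derivative
    (case n of 0 \<Rightarrow> - osc j \<omega> r m (of_real s)
       | Suc k \<Rightarrow> - of_nat n * integral {0<..} (ray_osc j \<omega> r m k s))) (at s)"
proof -
  let ?\<zeta> = "ray_dir j r"
  let ?D = "\<lambda>s t. (of_real t * ?\<zeta>) ^ n * osc' (ray_pt j r s t) * ?\<zeta>"
  \<comment> \<open>A window around \<open>s\<close> bounded away from 0, since the bound on
    \<open>osc'\<close> blows up at 0.\<close>
  define a b where "a = s / 2" and "b = 2 * s"
  have ab: "0 < a" "a < s" "s < b" using s by (auto simp: a_def b_def)
  \<comment> \<open>\<open>c1\<close> and \<open>c2\<close> collect the bound of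
    \<open>norm_osc'\<close> over the window: decreasing powers are taken at \<open>a\<close>, the
    power \<open>r - 1\<close> at \<open>b\<close>, and \<open>c2\<close> is the coefficient of
    \<open>t powr (r - 1)\<close>.\<close>
  define c1 where "c1 = a powr (m - 2) + \<omega> * r * a powr (m - 1) * (2 * b) powr (r - 1)"
  define c2 where "c2 = \<omega> * r * a powr (m - 1) * 2 powr (r - 1)"
  \<comment> \<open>The exponents are written to match \<open>has_integral_dominant\<close> with
    parameters \<open>n + 1\<close> and \<open>n + r\<close>.\<close>
  let ?h = "\<lambda>t. c1 * (t powr (real n + 1 - 1) * exp (- \<omega> * t powr r)) + c2 * (t powr (real n + r - 1) * exp (- \<omega> * t powr r))"
  have h: "?h integrable_on {0<..}"
    using has_integral_dominant[of "real n + 1"] has_integral_dominant[of "real n + r"] r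
    by (intro integrable_add integrable_on_mult_right) (auto simp: integrable_on_def)
  have bound: "norm (?D u t) \<le> ?h t" if u: "u \<in> {a<..<b}" and t: "t \<in> {0<..}" for u t
  proof -
    let ?e = "exp (- \<omega> * t powr r)"
    have "u powr (m - 2) \<le> a powr (m - 2)" "u powr (m - 1) \<le> a powr (m - 1)"
      using u ab m by (auto intro: powr_mono2')
    moreover have "(2 * u) powr (r - 1) \<le> (2 * b) powr (r - 1)"
      using u ab r by (intro powr_mono2) auto
    ultimately have "u powr (m - 2) + \<omega> * r * u powr (m - 1) * ((2 * u) powr (r - 1) + (2 * t) powr (r - 1))
        \<le> a powr (m - 2) + \<omega> * r * a powr (m - 1) * ((2 * b) powr (r - 1) + (2 * t) powr (r - 1))"
      using r \<omega> by (intro add_mono mult_mono order_refl) auto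
    also have "\<dots> = c1 + c2 * t powr (r - 1)"
      using t by (simp add: c1_def c2_def powr_mult algebra_simps)
    finally have "norm (osc' (ray_pt j r u t)) \<le> (c1 + c2 * t powr (r - 1)) * ?e"
      using norm_osc'[of u t] u t ab by (meson atLeastAtMost_iff exp_ge_zero greaterThanLessThan_iff greaterThan_iff mult_right_mono order.strict_trans order_trans)
    then have "norm (?D u t) \<le> t ^ n * ((c1 + c2 * t powr (r - 1)) * ?e)"
      using t by (simp add: norm_mult norm_power mult_left_mono)
    also have "\<dots> = ?h t"
      using t by (simp add: powr_add powr_diff powr_realpow field_simps)
    finally show ?thesis .
  qed
  have der: "((\<lambda>u. ray_osc j \<omega> r m n u t) has_vector_derivative ?D u t) (at u)"
    if u: "u \<in> {a<..<b}" and t: "t \<in> {0<..}" for u t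
  proof -
    have z: "of_real u + of_real t * ?\<zeta> \<notin> \<real>\<^sub>\<le>\<^sub>0"
      using ray_pt_not_nonpos[OF r, of u t j] u t ab by (simp add: ray_pt_def)
    have "((\<lambda>w. osc j \<omega> r m (w + of_real t * ?\<zeta>)) has_field_derivative
        osc' (of_real u + of_real t * ?\<zeta>) * 1) (at (of_real u))"
      by (rule DERIV_chain2[where f = "osc j \<omega> r m" and g = "\<lambda>w. w + of_real t * ?\<zeta>" and x = "of_real u"])
        (auto intro!: derivative_eq_intros osc_has_field_derivative z)
    then have "((\<lambda>w. (of_real t * ?\<zeta>) ^ n * osc j \<omega> r m (w + of_real t * ?\<zeta>) * ?\<zeta>) has_field_derivative ?D u t) (at (of_real u))"
      by (auto intro!: derivative_eq_intros simp: ray_pt_def)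
    then show ?thesis
      unfolding ray_osc_def ray_pt_def by (rule has_vector_derivative_real_field)
  qed
  have int: "ray_osc j \<omega> r m n u integrable_on {0<..}" if "u \<in> {a<..<b}" for u
    using that ab by (intro ray_osc_integrable) simp
  have s': "s \<in> {a<..<b}" using ab by simp
  note D = has_vector_derivative_integral_dominated[where f' = ?D, OF s' int der bound h]
  have "?D s absolutely_integrable_on {0<..}"
    using bound[OF s'] D(1) h by (rule absolutely_integrable_integrable_bound)
  note eq = integral_osc'_IBP[OF s this]
  show ?thesis
    unfolding eq[symmetric] by (rule D(2))
qed

section \<open>The chain of primitives, its values at 0 and its size\<close>

lemma phi_fun_continuous_on: "continuous_on {0..} (\<lambda>s. phi_fun j (Suc n) s \<omega> r m)"
  unfolding phi_fun_Suc by (intro continuous_intros continuous_on_integral_ray_osc)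

text \<open>The normalisation by \<open>(-1) ^ (n + 1) / fact n\<close> absorbs the factor
  \<open>- n\<close> from the integration by parts in \<open>t\<close>, so each member is a
  primitive of its predecessor and the first one of \<open>osc\<close>.\<close>

lemma phi_fun_has_vector_derivative:
  assumes "s > 0"
  shows "((\<lambda>s. phi_fun j (Suc n) s \<omega> r m) has_vector_derivative
    (case n of 0 \<Rightarrow> osc j \<omega> r m (of_real s) | Suc k \<Rightarrow> phi_fun j n s \<omega> r m)) (at s)"
proof -
  let ?c = "(-1) ^ (n + 1) / of_real (fact n) :: complex"
  have "((\<lambda>s. phi_fun j (Suc n) s \<omega> r m) has_vector_derivative ?c *
    (case n of 0 \<Rightarrow> - osc j \<omega> r m (of_real s)
       | Suc k \<Rightarrow> - of_nat n * integral {0<..} (ray_osc j \<omega> r m k s))) (at s)"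
    unfolding phi_fun_Suc
    by (intro has_vector_derivative_mult_right integral_ray_osc_has_vector_derivative assms)
  also have "?c * (case n of 0 \<Rightarrow> - osc j \<omega> r m (of_real s)
       | Suc k \<Rightarrow> - of_nat n * integral {0<..} (ray_osc j \<omega> r m k s)) =
     (case n of 0 \<Rightarrow> osc j \<omega> r m (of_real s) | Suc k \<Rightarrow> phi_fun j n s \<omega> r m)"
  proof (cases n)
    case (Suc k)
    have "(of_nat n :: complex) \<noteq> 0" unfolding Suc by (rule of_nat_neq_0)
    then show ?thesis
      unfolding phi_fun_Suc Suc by (simp add: field_simps del: of_nat_Suc)
  qed simp
  finally show ?thesis .
qed

text \<open>The ray from the origin turns the oscillation into
  \<open>exp (- \<omega> * t powr r)\<close>, leaving a Gamma integral times a constant phase. The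
  sign joins that of \<open>phi_fun\<close> with that of \<open>Theta_coeff\<close>.\<close>

lemma phi_fun_at_0:
  "phi_fun j (Suc n) 0 \<omega> r m =
     (-1) ^ (n + j) * Theta_coeff j (Suc n) r m * of_real (\<omega> powr (- ((real n + m) / r)))"
proof -
  let ?\<zeta> = "ray_dir j r" and ?a = "real n + m"
  let ?e = "exp ((-1) ^ (j + 1) * \<i> * of_real (pi / 2 * (?a / r)))"
  have "?e * of_real (t powr (?a - 1) * exp (- \<omega> * t powr r)) = ray_osc j \<omega> r m n 0 t"
    if t: "t \<in> {0<..}" for t
  proof -
    let ?z = "of_real t * ?\<zeta>"
    have nz: "?z \<noteq> 0" using t by simp
    have "(-1) ^ (j + 1) * \<i> * of_real \<omega> * ?z powr of_real r = of_real (- \<omega> * t powr r)"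
      using powr_ray_dir[OF r, of t j r] t r by (cases "even j") (auto simp: exp_eq_polar cis.ctr complex_eq_iff)
    \<comment> \<open>Writing the factor \<open>?\<zeta>\<close> as \<open>?z\<close> divided by
      \<open>t\<close> raises the exponent of \<open>?z\<close> to \<open>n + m\<close>.\<close>
    moreover have "?z ^ n * ?z powr of_real (m - 1) * ?\<zeta> = of_real (t powr (?a - 1)) * ?e"
    proof -
      have "?z ^ n * ?z powr of_real (m - 1) * ?\<zeta> = ?z powr of_nat n * ?z powr of_real (m - 1) * ?z / of_real t"
        using t nz by simp
      also have "\<dots> = ?z powr of_real ?a / of_real t"
        using nz by (simp add: powr_add powr_diff)
      also have "\<dots> = of_real (t powr ?a / t) * ?e"
        using powr_ray_dir[OF r, of t j ?a] t by simp
      also have "t powr ?a / t = t powr (?a - 1)"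
        using t by (simp add: powr_diff)
      finally show ?thesis .
    qed
    moreover have "ray_osc j \<omega> r m n 0 t = (?z ^ n * ?z powr of_real (m - 1) * ?\<zeta>) *
        exp ((-1) ^ (j + 1) * \<i> * of_real \<omega> * ?z powr of_real r)"
      by (simp add: ray_osc_def osc_def ray_pt_def mult_ac)
    ultimately show ?thesis
      unfolding of_real_mult[of "t powr (?a - 1)"] by (simp only: exp_of_real mult_ac)
  qed
  moreover have "((\<lambda>t. ?e * of_real (t powr (?a - 1) * exp (- \<omega> * t powr r))) has_integral
      ?e * of_real (1 / r * Gamma (?a / r) * \<omega> powr (- (?a / r)))) {0<..}"
    using has_integral_dominant[of ?a] m
    by (intro has_integral_mult_right has_integral_of_real) auto
  ultimately have "(ray_osc j \<omega> r m n 0 has_integral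
      ?e * of_real (1 / r * Gamma (?a / r) * \<omega> powr (- (?a / r)))) {0<..}"
    by (rule has_integral_eq)
  then show ?thesis
    by (simp add: phi_fun_Suc integral_unique power_add mult_ac)
qed

text \<open>The second estimate of \<open>norm_ray_osc\<close> is integrated; its
  \<open>t ^ n\<close> is the case \<open>a = n + 1\<close> of the Gamma integral.\<close>

lemma norm_phi_fun_le:
  assumes "s > 0"
  shows "norm (phi_fun j (Suc n) s \<omega> r m) \<le>
    s powr (m - 1) * (1 / fact n * (1 / r) * Gamma (real (Suc n) / r) * \<omega> powr (- (real (Suc n) / r)))"
proof -
  define C where "C = 1 / r * Gamma (real (Suc n) / r) * \<omega> powr (- (real (Suc n) / r))"
  let ?h = "\<lambda>t. s powr (m - 1) * (t powr (real (Suc n) - 1) * exp (- \<omega> * t powr r))"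
  have h: "(?h has_integral s powr (m - 1) * C) {0<..}"
    unfolding C_def by (intro has_integral_mult_right has_integral_dominant) auto
  have "norm (integral {0<..} (ray_osc j \<omega> r m n s)) \<le> integral {0<..} ?h"
  proof (rule integral_norm_bound_integral)
    show "norm (ray_osc j \<omega> r m n s t) \<le> ?h t" if "t \<in> {0<..}" for t
      using norm_ray_osc(2)[of s t n] assms that by (simp add: powr_realpow)
  qed (use h ray_osc_integrable[of s n] assms in \<open>auto simp: integrable_on_def\<close>)
  also have "\<dots> = s powr (m - 1) * C"
    using h by (rule integral_unique)
  finally have "norm (integral {0<..} (ray_osc j \<omega> r m n s)) / fact n \<le> s powr (m - 1) * C / fact n"
    by (rule divide_right_mono) simp
  moreover have "norm (phi_fun j (Suc n) s \<omega> r m) = norm (integral {0<..} (ray_osc j \<omega> r m n s)) / fact n"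
    by (simp add: phi_fun_Suc norm_mult norm_divide norm_power)
  ultimately show ?thesis
    by (simp add: C_def mult_ac)
qed

end

section \<open>Repeated integration by parts\<close>

lemma integral_Icc_eq_Ioc:
  fixes f :: "real \<Rightarrow> 'a::banach"
  shows "integral {a..b} f = integral {a<..b} f"
  by (rule integral_spike_set; rule negligible_subset[of "{a}"]) auto

lemma integrable_on_Icc_iff_Ioc:
  fixes f :: "real \<Rightarrow> 'a::banach"
  shows "f integrable_on {a..b} \<longleftrightarrow> f integrable_on {a<..b}"
  by (rule integrable_spike_set_eq; rule negligible_subset[of "{a}"]) auto

context osc_kernel
begin

text \<open>\<open>G\<close> is differentiated and \<open>osc\<close> is integrated along the chain \<open>phi_fun j 1\<close>, \<open>phi_fun j 2\<close>, ...\<close>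

lemma osc_primitive:
  fixes G :: "real \<Rightarrow> complex"
  assumes S: "S > 0" and N: "N \<ge> 1" and G: "Ck_on N G {0..S}"
    and flat: "\<And>n. n < N \<Longrightarrow> iter_deriv {0..S} n G S = 0"
  obtains P where "continuous_on {0..S} P"
    "\<And>s. s \<in> {0<..<S} \<Longrightarrow> (P has_vector_derivative G s * osc j \<omega> r m (of_real s)) (at s)"
    "P S - P 0 = - (\<Sum>n<N. (-1) ^ n * iter_deriv {0..S} n G 0 * phi_fun j (Suc n) 0 \<omega> r m) +
       (-1) ^ N * integral {0..S} (\<lambda>s. phi_fun j N s \<omega> r m * iter_deriv {0..S} N G s)"
proof -
  let ?d = "\<lambda>n. iter_deriv {0..S} n G" and ?\<phi> = "\<lambda>n s. phi_fun j n s \<omega> r m"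
  let ?w = "\<lambda>s. ?\<phi> N s * ?d N s"
  \<comment> \<open>The boundary terms of \<open>N\<close> integrations by parts, plus the remainder
    as an indefinite integral.\<close>
  define P where "P = (\<lambda>s. (\<Sum>n<N. (-1) ^ n * (?d n s * ?\<phi> (Suc n) s)) + (-1) ^ N * integral {0..s} ?w)"
  have cont_d: "continuous_on {0..S} (?d n)" if "n \<le> N" for n
    using Ck_on_continuous_on_iter_deriv[OF G that] .
  have cont_\<phi>: "continuous_on {0..S} (?\<phi> (Suc n))" for n
    using phi_fun_continuous_on by (rule continuous_on_subset) auto
  have cont_w: "continuous_on {0..S} ?w"
    using N cont_\<phi>[of "N - 1"] cont_d[of N] by (intro continuous_on_mult) auto
  \<comment> \<open>\<open>P\<close> is continuous up to 0 although \<open>osc\<close> is unbounded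
    there; together with the derivative in the interior this is what the fundamental theorem
    requires.\<close>
  have "continuous_on {0..S} P"
    unfolding P_def using cont_d cont_\<phi>
    by (intro continuous_on_add continuous_on_sum continuous_on_mult continuous_on_const
        indefinite_integral_continuous_1 integrable_continuous_real[OF cont_w]) auto
  moreover have "(P has_vector_derivative G s * osc j \<omega> r m (of_real s)) (at s)" if s: "s \<in> {0<..<S}" for s
  proof -
    let ?f = "\<lambda>n. (-1) ^ n * (?d n s * (case n of 0 \<Rightarrow> osc j \<omega> r m (of_real s) | Suc k \<Rightarrow> ?\<phi> n s))"
    have at: "at s within {0..S} = at s" using s by (intro at_within_Icc_at) auto
    have "(?d n has_vector_derivative ?d (Suc n) s) (at s)" if "n < N" for n
      using Ck_on_has_vector_derivative[OF G that, of s] s by (simp only: at) auto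
    then have der: "((\<lambda>s. (-1) ^ n * (?d n s * ?\<phi> (Suc n) s)) has_vector_derivative
        (-1) ^ n * (?d n s * (case n of 0 \<Rightarrow> osc j \<omega> r m (of_real s) | Suc k \<Rightarrow> ?\<phi> n s) + ?d (Suc n) s * ?\<phi> (Suc n) s)) (at s)"
      if "n < N" for n
      using phi_fun_has_vector_derivative[of s n] s that
      by (intro has_vector_derivative_mult_right has_vector_derivative_mult) auto
    have eq: "(-1) ^ n * (?d n s * (case n of 0 \<Rightarrow> osc j \<omega> r m (of_real s) | Suc k \<Rightarrow> ?\<phi> n s) + ?d (Suc n) s * ?\<phi> (Suc n) s)
        = ?f n - ?f (Suc n)" for n
      by (simp add: algebra_simps)
    have "((\<lambda>s. (-1) ^ n * (?d n s * ?\<phi> (Suc n) s)) has_vector_derivative ?f n - ?f (Suc n)) (at s)"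
      if "n < N" for n
      by (rule has_vector_derivative_eq_rhs[OF der[OF that] eq])
    then have "((\<lambda>s. \<Sum>n<N. (-1) ^ n * (?d n s * ?\<phi> (Suc n) s)) has_vector_derivative (\<Sum>n<N. ?f n - ?f (Suc n))) (at s)"
      by (intro has_vector_derivative_sum) auto
    moreover have "((\<lambda>s. integral {0..s} ?w) has_vector_derivative ?w s) (at s)"
      using integral_has_vector_derivative[OF cont_w, of s] s by (simp only: at) auto
    ultimately have "(P has_vector_derivative (\<Sum>n<N. ?f n - ?f (Suc n)) + (-1) ^ N * ?w s) (at s)"
      unfolding P_def by (intro has_vector_derivative_add has_vector_derivative_mult_right)
    \<comment> \<open>The sum telescopes to \<open>?f 0 - ?f N\<close>. As \<open>N \<ge> 1\<close>,
      the derivative of the remainder integral cancels \<open>?f N\<close>.\<close>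
    moreover have "(\<Sum>n<N. ?f n - ?f (Suc n)) + (-1) ^ N * ?w s = G s * osc j \<omega> r m (of_real s)"
      using sum_lessThan_telescope'[of ?f N] N by (cases N) (auto simp: mult_ac)
    ultimately show ?thesis by simp
  qed
  moreover have "P S - P 0 = - (\<Sum>n<N. (-1) ^ n * ?d n 0 * ?\<phi> (Suc n) 0) + (-1) ^ N * integral {0..S} ?w"
    using flat by (simp add: P_def mult.assoc)
  ultimately show ?thesis by (rule that)
qed

text \<open>The pointwise bound holds for \<open>s > 0\<close>, hence the passage to
  \<open>{0<..S}\<close>. The weight is integrable because \<open>m > 0\<close>, and
  \<open>g\<close> is bounded by compactness.\<close>

lemma norm_integral_phi_fun_le:
  fixes g :: "real \<Rightarrow> complex"
  assumes S: "S > 0" and N: "N \<ge> 1" and g: "continuous_on {0..S} g"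
  shows "norm (integral {0..S} (\<lambda>s. phi_fun j N s \<omega> r m * g s)) \<le>
    1 / fact (N - 1) * (1 / r) * Gamma (real N / r) * integral {0..S} (\<lambda>s. s powr (m - 1) * norm (g s)) *
    \<omega> powr (- (real N / r))"
proof -
  define C where "C = 1 / fact (N - 1) * (1 / r) * Gamma (real N / r) * \<omega> powr (- (real N / r))"
  let ?f = "\<lambda>s. phi_fun j N s \<omega> r m * g s" and ?h = "\<lambda>s. s powr (m - 1) * norm (g s)"
  have cont_\<phi>: "continuous_on {0..S} (\<lambda>s. phi_fun j (Suc n) s \<omega> r m)" for n
    using phi_fun_continuous_on by (rule continuous_on_subset) auto
  have "continuous_on {0..S} ?f"
    using N cont_\<phi>[of "N - 1"] g by (intro continuous_on_mult) auto
  then have f: "?f integrable_on {0<..S}"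
    using integrable_continuous_real integrable_on_Icc_iff_Ioc by blast
  obtain B where B: "\<And>s. s \<in> {0..S} \<Longrightarrow> norm (g s) \<le> B"
    using compact_continuous_image[OF g] by (metis bounded_iff compact_Icc compact_imp_bounded imageI)
  have pw: "(\<lambda>s. s powr (m - 1) * B) integrable_on {0<..S}"
    using has_integral_powr_from_0[of "m - 1" S] m S unfolding integrable_on_Icc_iff_Ioc[symmetric]
    by (intro integrable_on_mult_left) (auto simp: integrable_on_def)
  have h: "?h integrable_on {0<..S}"
  proof (rule measurable_bounded_by_integrable_imp_integrable[OF _ pw])
    have "continuous_on {0<..S} ?h"
      using g by (intro continuous_intros) (auto intro: continuous_on_subset)
    then show "?h \<in> borel_measurable (lebesgue_on {0<..S})"
      by (rule continuous_imp_measurable_on_sets_lebesgue) auto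
    show "norm (?h s) \<le> s powr (m - 1) * B" if "s \<in> {0<..S}" for s
      using B[of s] that by (auto intro!: mult_left_mono)
  qed auto
  have "norm (integral {0<..S} ?f) \<le> integral {0<..S} (\<lambda>s. C * ?h s)"
  proof (rule integral_norm_bound_integral[OF f])
    show "(\<lambda>s. C * ?h s) integrable_on {0<..S}"
      using h by (rule integrable_on_mult_right)
    show "norm (?f s) \<le> C * ?h s" if s: "s \<in> {0<..S}" for s
    proof -
      have "norm (phi_fun j N s \<omega> r m) \<le> s powr (m - 1) * C"
        using norm_phi_fun_le[of s "N - 1"] s N by (simp add: C_def)
      then have "norm (phi_fun j N s \<omega> r m) * norm (g s) \<le> s powr (m - 1) * C * norm (g s)"
        by (rule mult_right_mono) simp
      then show ?thesis by (simp add: norm_mult mult_ac)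
    qed
  qed
  then have "norm (integral {0<..S} ?f) \<le> C * integral {0<..S} ?h"
    by (simp only: integral_mult_right)
  then show ?thesis
    by (simp only: integral_Icc_eq_Ioc C_def mult_ac)
qed

end

section \<open>The phase coordinate\<close>

lemma continuous_on_rpow: "a \<ge> 0 \<Longrightarrow> continuous_on {0..} (\<lambda>x. rpow x a)"
  using continuous_on_powr'[of "{0..}" "\<lambda>x. x" "\<lambda>_. a"]
  by (cases "a = 0") (simp_all add: rpow_def[abs_def])

lemma rpow_nonneg: "rpow x a \<ge> 0"
  by (simp add: rpow_def)

lemma rpow_eq_powr: "x > 0 \<Longrightarrow> rpow x a = x powr a"
  by (simp add: rpow_def)

lemma rpow_mult: "x > 0 \<Longrightarrow> y \<ge> 0 \<Longrightarrow> rpow (y * x) a = x powr a * rpow y a"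
  by (simp add: rpow_def powr_mult)

text \<open>Model of one endpoint: \<open>x\<close> is the distance to it, \<open>\<Psi>\<close> the
  oriented phase increment, and \<open>h\<close> the part of its derivative that stays positive on
  the whole interval.\<close>

locale phase_fun =
  fixes L r :: real and N :: nat and h \<Psi> :: "real \<Rightarrow> real"
  assumes L: "L > 0" and r: "r \<ge> 1" and h: "Ck_on N h {0..L}" "\<And>x. x \<in> {0..L} \<Longrightarrow> h x > 0"
    and \<Psi>0: "\<Psi> 0 = 0"
    and \<Psi>: "\<And>x. x \<in> {0..L} \<Longrightarrow>
      (\<Psi> has_real_derivative rpow x (r - 1) * h x) (at x within {0..L})"
begin

definition J :: "real \<Rightarrow> real" where
  "J x = integral {0..1} (\<lambda>y. rpow y (r - 1) * h (y * x))"

text \<open>This is the smooth positive factor in the phase coordinate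
  \<open>\<Phi> x = x * E x\<close>.\<close>

definition E :: "real \<Rightarrow> real" where "E x = J x powr (1 / r)"

text \<open>The derivative of \<open>\<Phi>\<close>, written without powers of \<open>x\<close> so
  that its smoothness at 0 is visible.\<close>

definition D :: "real \<Rightarrow> real" where "D x = 1 / r * E x powr (1 - r) * h x"

definition \<Phi> :: "real \<Rightarrow> real" where "\<Phi> x = \<Psi> x powr (1 / r)"

definition X :: "real \<Rightarrow> real" where "X = inv_into {0..L} \<Phi>"

lemma cont_rpow: "continuous_on {0..1} (\<lambda>y. rpow y (r - 1))"
  using continuous_on_rpow[of "r - 1"] r by (auto intro: continuous_on_subset)

lemma integral_rpow: "((\<lambda>y. rpow y (r - 1)) has_integral 1 / r) {0..1}"
proof -
  have "((\<lambda>y. y powr (r - 1)) has_integral 1 / r) {0..1}"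
    using has_integral_powr_from_0[of "r - 1" 1] r by simp
  then show ?thesis
    by (rule has_integral_spike_finite[of "{0}", rotated 2]) (auto simp: rpow_def)
qed

lemma Ck_J: "Ck_on N J {0..L}"
  unfolding J_def[abs_def] using Ck_on_weighted_dilation[OF L h(1) cont_rpow] .

lemma dilate_mem: "x \<in> {0..L} \<Longrightarrow> y \<in> {0..1} \<Longrightarrow> y * x \<in> {0..L}" for x y :: real
  using mult_left_le_one_le[of x y] by auto

text \<open>The minimum of \<open>h\<close> on the compact interval is positive, and the weight has
  total mass \<open>1 / r\<close>.\<close>

lemma J_pos:
  assumes x: "x \<in> {0..L}"
  shows "J x > 0"
proof -
  have "continuous_on {0..L} h" using Ck_on_imp_continuous_on h(1) by blast
  then obtain x0 where x0: "x0 \<in> {0..L}" "\<And>y. y \<in> {0..L} \<Longrightarrow> h x0 \<le> h y"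
    using continuous_attains_inf[of "{0..L}" h] L by auto
  have "0 < h x0 * (1 / r)" using h(2)[OF x0(1)] r by simp
  also have "h x0 * (1 / r) \<le> J x"
  proof (rule has_integral_le)
    show "((\<lambda>y. h x0 * rpow y (r - 1)) has_integral h x0 * (1 / r)) {0..1}"
      using integral_rpow by (rule has_integral_mult_right)
    have "continuous_on {0..1} (\<lambda>y. rpow y (r - 1) * h (y * x))"
      using dilate_mem[OF x]
      by (intro continuous_on_mult cont_rpow continuous_on_compose2[OF \<open>continuous_on {0..L} h\<close>] continuous_intros) auto
    then show "((\<lambda>y. rpow y (r - 1) * h (y * x)) has_integral J x) {0..1}"
      unfolding J_def by (intro integrable_integral integrable_continuous_real)
    show "h x0 * rpow y (r - 1) \<le> rpow y (r - 1) * h (y * x)" if "y \<in> {0..1}" for y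
      using x0(2)[OF dilate_mem[OF x that]] by (simp add: mult.commute[of _ "rpow _ _"] mult_left_mono rpow_nonneg)
  qed
  finally show ?thesis .
qed

lemma J_0: "J 0 = h 0 / r"
  using integral_unique[OF has_integral_mult_left[OF integral_rpow, of "h 0"]] by (simp add: J_def)

text \<open>The fundamental theorem is applied to \<open>\<Psi> (y * x)\<close> as a function of
  \<open>y\<close>; homogeneity of the weight extracts \<open>x powr r\<close>.\<close>

lemma \<Psi>_eq:
  assumes x: "x \<in> {0..L}"
  shows "\<Psi> x = x powr r * J x"
proof (cases "x = 0")
  case False
  then have "x > 0" using x by simp
  have "((\<lambda>y. x powr r * (rpow y (r - 1) * h (y * x))) has_integral \<Psi> (1 * x) - \<Psi> (0 * x)) {0..1}"
  proof (rule fundamental_theorem_of_calculus)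
    fix y :: real assume y: "y \<in> {0..1}"
    have "((\<lambda>y. \<Psi> (y * x)) has_vector_derivative x *\<^sub>R (rpow (y * x) (r - 1) * h (y * x))) (at y within {0..1})"
      using \<Psi>[OF dilate_mem[OF x y]] dilate_mem[OF x]
      by (intro has_vector_derivative_compose_within[where B = "{0..L}"])
        (auto intro!: derivative_eq_intros simp: has_real_derivative_iff_has_vector_derivative[symmetric])
    then show "((\<lambda>y. \<Psi> (y * x)) has_vector_derivative x powr r * (rpow y (r - 1) * h (y * x))) (at y within {0..1})"
      using \<open>x > 0\<close> y by (simp add: rpow_mult powr_diff mult.assoc)
  qed simp
  from integral_unique[OF this] show ?thesis by (simp add: \<Psi>0 J_def)
qed (simp add: \<Psi>0)

lemma E_pos: "x \<in> {0..L} \<Longrightarrow> E x > 0"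
  using J_pos[of x] by (simp add: E_def)

lemma Ck_E: "Ck_on N E {0..L}"
  unfolding E_def[abs_def] by (rule Ck_on_powr[OF L Ck_J J_pos])

lemma \<Phi>_eq: "x \<in> {0..L} \<Longrightarrow> \<Phi> x = x * E x"
  using r J_pos[of x] by (simp add: \<Phi>_def \<Psi>_eq E_def powr_mult powr_powr)

lemma \<Phi>_powr: "x \<in> {0..L} \<Longrightarrow> \<Phi> x powr r = \<Psi> x"
  using r J_pos[of x] by (simp add: \<Phi>_def powr_powr \<Psi>_eq)

lemma D_pos: "x \<in> {0..L} \<Longrightarrow> D x > 0"
  using r E_pos[of x] h(2)[of x] by (simp add: D_def)

lemma Ck_D: "Ck_on N D {0..L}"
  unfolding D_def[abs_def]
  by (rule Ck_on_mult[OF L Ck_on_mult[OF L Ck_on_const[OF L] Ck_on_powr[OF L Ck_E E_pos]] h(1)])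

text \<open>At 0 the difference quotient is \<open>E\<close>, whose value there is
  \<open>D 0\<close> because \<open>h 0 = r * J 0\<close>. For positive \<open>x\<close> the chain
  rule applies and all powers of \<open>x\<close> cancel.\<close>

lemma \<Phi>_has_vector_derivative:
  assumes x: "x \<in> {0..L}"
  shows "(\<Phi> has_vector_derivative D x) (at x within {0..L})"
proof (cases "x = 0")
  case True
  have "E 0 = D 0"
  proof -
    have "J 0 > 0" "h 0 = r * J 0" using J_pos[of 0] L r by (auto simp: J_0)
    then have "D 0 = J 0 powr (1 / r * (1 - r)) * J 0 powr 1"
      using r by (simp add: D_def E_def powr_powr)
    also have "\<dots> = J 0 powr (1 / r)"
      unfolding powr_add[symmetric] using r by (simp add: field_simps)
    finally show ?thesis by (simp add: E_def)
  qed
  have "(E \<longlongrightarrow> D 0) (at 0 within {0..L})"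
    using Ck_on_imp_continuous_on[OF Ck_E] L \<open>E 0 = D 0\<close> by (force simp: continuous_on_def)
  moreover have "(E \<longlongrightarrow> D 0) (at 0 within {0..L}) \<longleftrightarrow>
      ((\<lambda>y. (\<Phi> y - \<Phi> 0) /\<^sub>R (y - 0)) \<longlongrightarrow> D 0) (at 0 within {0..L})"
    by (intro Lim_cong_within refl) (use L \<Phi>_eq in auto)
  ultimately show ?thesis
    unfolding True has_vector_derivative_iff_quotient by blast
next
  case False
  then have x0: "x > 0" and J: "J x > 0" using x J_pos by auto
  have "\<Psi> x > 0" using x0 J by (simp add: \<Psi>_eq[OF x])
  then have "(\<Phi> has_real_derivative 1 / r * \<Psi> x powr (1 / r - 1) * (rpow x (r - 1) * h x)) (at x within {0..L})"
    unfolding \<Phi>_def[abs_def] using \<Psi>[OF x]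
    by (auto intro!: derivative_eq_intros simp: powr_diff field_simps)
  moreover have "\<Psi> x powr (1 / r - 1) * rpow x (r - 1) = E x powr (1 - r)"
  proof -
    have "\<Psi> x powr (1 / r - 1) * rpow x (r - 1) = x powr (r * (1 / r - 1)) * x powr (r - 1) * J x powr (1 / r - 1)"
      using x0 J by (simp add: \<Psi>_eq[OF x] powr_mult powr_powr rpow_eq_powr)
    also have "x powr (r * (1 / r - 1)) * x powr (r - 1) = x powr 0"
      unfolding powr_add[symmetric] using r by (simp add: field_simps)
    also have "J x powr (1 / r - 1) = E x powr (1 - r)"
      unfolding E_def powr_powr using r by (simp add: field_simps)
    finally show ?thesis using x0 by simp
  qed
  ultimately show ?thesis
    by (simp add: has_real_derivative_iff_has_vector_derivative D_def mult.assoc[symmetric])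
qed

lemma \<Phi>_cont: "continuous_on {0..L} \<Phi>"
  using \<Phi>_has_vector_derivative by (meson continuous_on_eq_continuous_within has_vector_derivative_continuous)

lemma \<Phi>_strict_mono:
  assumes "0 \<le> x" "x < y" "y \<le> L"
  shows "\<Phi> x < \<Phi> y"
proof (rule DERIV_pos_imp_increasing_open[OF assms(2)])
  fix z assume "x < z" "z < y"
  then have "(\<Phi> has_vector_derivative D z) (at z)" "D z > 0"
    using \<Phi>_has_vector_derivative[of z] D_pos[of z] at_within_Icc_at[of 0 z L] assms by auto
  then show "\<exists>d. (\<Phi> has_real_derivative d) (at z) \<and> 0 < d"
    by (auto simp: has_real_derivative_iff_has_vector_derivative)
qed (use assms in \<open>auto intro: continuous_on_subset[OF \<Phi>_cont]\<close>)

lemma \<Phi>_0: "\<Phi> 0 = 0"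
  by (simp add: \<Phi>_def \<Psi>0)

lemma \<Phi>L_pos: "\<Phi> L > 0"
  using \<Phi>_strict_mono[of 0 L] L \<Phi>_0 by simp

lemma \<Phi>_inj: "inj_on \<Phi> {0..L}"
  by (rule linorder_inj_onI) (use \<Phi>_strict_mono in force)+

lemma \<Phi>_image: "\<Phi> ` {0..L} = {0..\<Phi> L}"
proof (intro equalityI subsetI)
  fix s assume "s \<in> \<Phi> ` {0..L}"
  then obtain x where "x \<in> {0..L}" "s = \<Phi> x" by blast
  then show "s \<in> {0..\<Phi> L}"
    using \<Phi>_strict_mono[of 0 x] \<Phi>_strict_mono[of x L] \<Phi>_0 by (cases "x = 0"; cases "x = L") force+
next
  fix s assume "s \<in> {0..\<Phi> L}"
  then obtain x where "0 \<le> x" "x \<le> L" "\<Phi> x = s"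
    using IVT'[of \<Phi> 0 s L] L \<Phi>_cont \<Phi>_0 by auto
  then show "s \<in> \<Phi> ` {0..L}" by auto
qed

lemma X_mem: "s \<in> {0..\<Phi> L} \<Longrightarrow> X s \<in> {0..L}"
  unfolding X_def using inv_into_into[of s \<Phi> "{0..L}"] \<Phi>_image by simp

lemma \<Phi>_X: "s \<in> {0..\<Phi> L} \<Longrightarrow> \<Phi> (X s) = s"
  unfolding X_def using f_inv_into_f[of s \<Phi> "{0..L}"] \<Phi>_image by simp

lemma X_\<Phi>: "x \<in> {0..L} \<Longrightarrow> X (\<Phi> x) = x"
  unfolding X_def using \<Phi>_inj by simp

lemma \<Phi>_mem: "x \<in> {0..L} \<Longrightarrow> \<Phi> x \<in> {0..\<Phi> L}"
  using \<Phi>_image by blast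

lemma X_has_vector_derivative:
  "s \<in> {0..\<Phi> L} \<Longrightarrow> (X has_vector_derivative 1 / D (X s)) (at s within {0..\<Phi> L})"
  by (rule Ck_on_inverse_function(1)[OF L \<Phi>L_pos \<Phi>_has_vector_derivative Ck_D D_pos])
    (assumption | (intro conjI X_mem \<Phi>_X \<Phi>_mem X_\<Phi>; assumption))+

lemma Ck_X: "Ck_on N X {0..\<Phi> L}"
proof (rule Ck_on_SucD)
  show "Ck_on (Suc N) X {0..\<Phi> L}"
    by (rule Ck_on_inverse_function(2)[OF L \<Phi>L_pos \<Phi>_has_vector_derivative Ck_D D_pos])
      (assumption | (intro conjI X_mem \<Phi>_X \<Phi>_mem X_\<Phi>; assumption))+
qed

end

section \<open>The expansion at an endpoint\<close>

lemma Ck_on_const_diff: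
  fixes f :: "real \<Rightarrow> 'a::real_normed_algebra_1"
  assumes "a < b" "Ck_on n f {a..b}"
  shows "Ck_on n (\<lambda>x. c - f x) {a..b}"
  using Ck_on_add[OF assms(1) Ck_on_const[OF assms(1), of n c]
      Ck_on_bounded_linear[OF assms(1) bounded_linear_minus[OF bounded_linear_ident] assms(2)]]
  by simp

lemma Ck_on_affine:
  fixes c d :: real
  assumes "a < b"
  shows "Ck_on n (\<lambda>x. c + d * x) {a..b}"
  by (intro Ck_on_add Ck_on_mult Ck_on_const Ck_on_ident assms)

text \<open>One of the two pieces in the model: \<open>\<kappa>\<close> is the amplitude as a
  function of \<open>x\<close>, and \<open>w\<close> is the cut-off, equal to 1 near the singular
  endpoint and flat at the other end.\<close>

locale phase_expansion = phase_fun L r N h \<Psi> + osc_kernel j \<omega> r m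
  for L r :: real and N j :: nat and h \<Psi> :: "real \<Rightarrow> real" and \<omega> m :: real +
  fixes \<kappa> :: "real \<Rightarrow> complex" and w :: "real \<Rightarrow> real" and \<eta> :: real
  assumes N: "N \<ge> 1" and \<kappa>: "Ck_on N \<kappa> {0..L}" and w: "flat_at N w {0..L} L"
    and \<eta>: "0 < \<eta>" "\<eta> < L" and w_1: "\<And>x. x \<in> {0..\<eta>} \<Longrightarrow> w x = 1"
begin

definition k :: "real \<Rightarrow> complex" where "k s = \<kappa> (X s)"

definition G :: "real \<Rightarrow> complex" where "G s = of_real (w (X s)) * k s"

text \<open>Flatness of the cut-off passes through the coordinate change and the product, which
  removes all boundary terms at the far end.\<close>

lemma flat_G: "flat_at N G {0..\<Phi> L} (\<Phi> L)"
proof -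
  have "X (\<Phi> L) = L" using X_\<Phi>[of L] L by simp
  then have flat: "flat_at N (\<lambda>s. w (X s)) {0..\<Phi> L} (\<Phi> L)"
    using X_mem by (intro flat_at_compose[OF \<Phi>L_pos _ _ Ck_X, of _ _ 0 L]) (use w \<Phi>L_pos in auto)
  have "bounded_bilinear (\<lambda>x::real. \<lambda>z::complex. of_real x * z)"
    using bounded_bilinear_scaleR[where ?'a = complex] by (simp add: scaleR_conv_of_real[abs_def])
  moreover have "Ck_on N k {0..\<Phi> L}"
    unfolding k_def[abs_def] using X_mem
    by (intro Ck_on_compose[OF \<Phi>L_pos \<kappa> Ck_X]) auto
  ultimately show ?thesis
    unfolding G_def[abs_def] using \<Phi>L_pos flat
    by (intro flat_at_bilinear[where h = "\<lambda>x z. of_real x * z"]) auto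
qed

text \<open>Monotonicity of \<open>\<Phi>\<close> carries the region where the cut-off is 1 to a
  neighbourhood of \<open>s = 0\<close>, so the cut-off does not affect the coefficients of the
  expansion.\<close>

lemma iter_deriv_G_0: "iter_deriv {0..\<Phi> L} n G 0 = iter_deriv {0..\<Phi> L} n k 0"
proof (rule iter_deriv_cong_open[of "{..<\<Phi> \<eta>}"])
  have "\<Phi> \<eta> > 0" using \<Phi>_strict_mono[of 0 \<eta>] \<eta> \<Phi>_0 by simp
  then show "0 \<in> {0..\<Phi> L} \<inter> {..<\<Phi> \<eta>}" using \<Phi>L_pos by simp
  fix s assume s: "s \<in> {0..\<Phi> L} \<inter> {..<\<Phi> \<eta>}"
  then have "X s < \<eta>"
    using \<Phi>_strict_mono[of \<eta> "X s"] \<Phi>_X[of s] X_mem[of s] \<eta> by (cases "\<eta> = X s") force+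
  then have "w (X s) = 1" using w_1 X_mem[of s] s by auto
  then show "G s = k s" by (simp add: G_def)
qed simp

text \<open>The primitive in \<open>s\<close> composed with \<open>\<Phi>\<close> is a primitive in
  \<open>x\<close>, so the fundamental theorem performs the substitution and proves integrability at
  the same time.\<close>

lemma has_integral_expansion:
  "((\<lambda>x. of_real (w x) * \<kappa> x * of_real (D x) * osc j \<omega> r m (of_real (\<Phi> x))) has_integral
     - (\<Sum>n<N. (-1) ^ n * iter_deriv {0..\<Phi> L} n k 0 * phi_fun j (Suc n) 0 \<omega> r m) +
     (-1) ^ N * integral {0..\<Phi> L} (\<lambda>s. phi_fun j N s \<omega> r m * iter_deriv {0..\<Phi> L} N G s)) {0..L}"
proof -
  have "Ck_on N G {0..\<Phi> L}" "\<And>n. n < N \<Longrightarrow> iter_deriv {0..\<Phi> L} n G (\<Phi> L) = 0"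
    using flat_G unfolding flat_at_def by auto
  then obtain P where P: "continuous_on {0..\<Phi> L} P"
    "\<And>s. s \<in> {0<..<\<Phi> L} \<Longrightarrow> (P has_vector_derivative G s * osc j \<omega> r m (of_real s)) (at s)"
    "P (\<Phi> L) - P 0 = - (\<Sum>n<N. (-1) ^ n * iter_deriv {0..\<Phi> L} n G 0 * phi_fun j (Suc n) 0 \<omega> r m) +
       (-1) ^ N * integral {0..\<Phi> L} (\<lambda>s. phi_fun j N s \<omega> r m * iter_deriv {0..\<Phi> L} N G s)"
    using osc_primitive[OF \<Phi>L_pos N] by blast
  have "((\<lambda>x. of_real (w x) * \<kappa> x * of_real (D x) * osc j \<omega> r m (of_real (\<Phi> x))) has_integral
      P (\<Phi> L) - P (\<Phi> 0)) {0..L}"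
  proof (rule fundamental_theorem_of_calculus_interior)
    show "continuous_on {0..L} (\<lambda>x. P (\<Phi> x))"
      using \<Phi>_mem by (intro continuous_on_compose2[OF P(1) \<Phi>_cont]) auto
    fix x assume x: "x \<in> {0<..<L}"
    have "\<Phi> x \<in> {0<..<\<Phi> L}"
      using \<Phi>_strict_mono[of 0 x] \<Phi>_strict_mono[of x L] x \<Phi>_0 by simp
    moreover have "(\<Phi> has_vector_derivative D x) (at x)"
      using \<Phi>_has_vector_derivative[of x] x at_within_Icc_at[of 0 x L] by simp
    ultimately have "((\<lambda>x. P (\<Phi> x)) has_vector_derivative
        D x *\<^sub>R (G (\<Phi> x) * osc j \<omega> r m (of_real (\<Phi> x)))) (at x)"
      using P(2) by (intro has_vector_derivative_compose_within[where B = UNIV]) auto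
    then show "((\<lambda>x. P (\<Phi> x)) has_vector_derivative
        of_real (w x) * \<kappa> x * of_real (D x) * osc j \<omega> r m (of_real (\<Phi> x))) (at x)"
      using X_\<Phi>[of x] x by (simp add: G_def k_def scaleR_conv_of_real mult_ac)
  qed (use L in simp)
  then show ?thesis
    unfolding \<Phi>_0 P(3) iter_deriv_G_0 .
qed

end

section \<open>Reduction of both endpoints to the model\<close>

locale setting =
  fixes p \<rho> \<mu> :: "nat \<Rightarrow> real" and \<eta> \<omega> :: real and N j :: nat
    and \<psi> \<psi>t \<nu> :: "real \<Rightarrow> real" and U ut :: "real \<Rightarrow> complex"
  assumes p: "p 1 < p 2" and N1: "N \<ge> 1"
    and \<rho>: "\<And>i. i \<in> {1, 2} \<Longrightarrow> \<rho> i \<ge> 1" and \<mu>: "\<And>i. i \<in> {1, 2} \<Longrightarrow> 0 < \<mu> i \<and> \<mu> i < 1"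
    and \<psi>: "\<And>q. q \<in> {p 1..p 2} \<Longrightarrow> (\<psi> has_real_derivative
           rpow (q - p 1) (\<rho> 1 - 1) * rpow (p 2 - q) (\<rho> 2 - 1) * \<psi>t q) (at q within {p 1..p 2})"
    and \<psi>t: "Ck_on N \<psi>t {p 1..p 2}" "\<And>q. q \<in> {p 1..p 2} \<Longrightarrow> \<psi>t q > 0"
    and U: "\<And>q. q \<in> {p 1<..<p 2} \<Longrightarrow>
           U q = of_real ((q - p 1) powr (\<mu> 1 - 1) * (p 2 - q) powr (\<mu> 2 - 1)) * ut q"
    and ut: "Ck_on N ut {p 1..p 2}"
    and \<eta>: "0 < \<eta>" "\<eta> < (p 2 - p 1) / 2"
    and \<nu>: "Ck_on N \<nu> {p 1..p 2}" and \<nu>_1: "\<And>q. q \<in> {p 1..p 1 + \<eta>} \<Longrightarrow> \<nu> q = 1"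
    and \<nu>_0: "\<And>q. q \<in> {p 2 - \<eta>..p 2} \<Longrightarrow> \<nu> q = 0"
    and \<omega>: "\<omega> > 0" and j: "j \<in> {1, 2}"
begin

text \<open>The orientation sign: \<open>pt\<close> runs from \<open>p j\<close> into the interval,
  so both endpoints share one argument.\<close>

definition sg :: real where "sg = (-1) ^ (j + 1)"
definition L :: real where "L = p 2 - p 1 - \<eta>"
definition pt :: "real \<Rightarrow> real" where "pt x = p j + sg * x"
definition \<Psi> :: "real \<Rightarrow> real" where "\<Psi> x = sg * (\<psi> (pt x) - \<psi> (p j))"
text \<open>The index \<open>3 - j\<close> is that of the opposite endpoint. For \<open>x\<close> up
  to \<open>L\<close> the distance to it is at least \<open>\<eta>\<close>, so its power is
  smooth.\<close>

definition h :: "real \<Rightarrow> real" where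
  "h x = (p 2 - p 1 - x) powr (\<rho> (3 - j) - 1) * \<psi>t (pt x)"
definition w :: "real \<Rightarrow> real" where "w x = (if j = 1 then \<nu> (pt x) else 1 - \<nu> (pt x))"

lemma j_cases: obtains "j = 1" "sg = 1" | "j = 2" "sg = -1"
  using j that unfolding sg_def by auto

lemma sg_sq: "sg * sg = 1"
  by (cases rule: j_cases) auto

lemma L_pos: "L > 0" and \<eta>_less_L: "\<eta> < L"
  using \<eta> p by (auto simp: L_def)

lemma pt_mem: "x \<in> {0..p 2 - p 1} \<Longrightarrow> pt x \<in> {p 1..p 2}"
  unfolding pt_def by (cases rule: j_cases) auto

lemma L_less: "x \<in> {0..L} \<Longrightarrow> x \<in> {0..p 2 - p 1}" "x \<in> {0..L} \<Longrightarrow> p 2 - p 1 - x > 0"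
  using \<eta> by (auto simp: L_def)

lemma Ck_pt: "Ck_on n pt {0..L}"
  unfolding pt_def[abs_def] by (rule Ck_on_affine[OF L_pos])

lemma Ck_compose_pt: "Ck_on n f {p 1..p 2} \<Longrightarrow> Ck_on n (\<lambda>x. f (pt x)) {0..L}"
  by (rule Ck_on_compose[OF L_pos _ Ck_pt]) (use pt_mem L_less in auto)

lemma Ck_gap: "Ck_on n (\<lambda>x. (p 2 - p 1 - x) powr c) {0..L}"
  using Ck_on_powr[OF L_pos Ck_on_affine[OF L_pos, of n "p 2 - p 1" "-1"], of c] L_less(2) by simp

sublocale phase_fun L "\<rho> j" N h \<Psi>
proof
  show "L > 0" by (rule L_pos)
  show "\<rho> j \<ge> 1" using \<rho> j by blast
  show "Ck_on N h {0..L}"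
    unfolding h_def[abs_def] by (intro Ck_on_mult Ck_compose_pt Ck_gap L_pos \<psi>t)
  show "h x > 0" if "x \<in> {0..L}" for x
    using \<psi>t(2) pt_mem L_less[OF that] by (simp add: h_def)
  show "\<Psi> 0 = 0" by (simp add: \<Psi>_def pt_def)
  fix x assume x: "x \<in> {0..L}"
  have "pt ` {0..L} \<subseteq> {p 1..p 2}" using pt_mem L_less by blast
  moreover have "(pt has_real_derivative sg) (at x within {0..L})"
    unfolding pt_def by (auto intro!: derivative_eq_intros)
  ultimately have "((\<lambda>x. \<psi> (pt x)) has_real_derivative
      sg * (rpow (pt x - p 1) (\<rho> 1 - 1) * rpow (p 2 - pt x) (\<rho> 2 - 1) * \<psi>t (pt x))) (at x within {0..L})"
    using has_vector_derivative_compose_within[of pt sg x "{0..L}" \<psi> _ "{p 1..p 2}"]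
      \<psi>[OF pt_mem[OF L_less(1)[OF x]]]
    by (simp add: has_real_derivative_iff_has_vector_derivative)
  from DERIV_cmult[OF DERIV_diff[OF this DERIV_const[of "\<psi> (p j)"]], of sg]
  have "(\<Psi> has_real_derivative sg * sg * (rpow (pt x - p 1) (\<rho> 1 - 1) * rpow (p 2 - pt x) (\<rho> 2 - 1) * \<psi>t (pt x))) (at x within {0..L})"
    unfolding \<Psi>_def[abs_def] by (simp add: mult.assoc)
  moreover have "rpow (pt x - p 1) (\<rho> 1 - 1) * rpow (p 2 - pt x) (\<rho> 2 - 1) * \<psi>t (pt x) = rpow x (\<rho> j - 1) * h x"
    using L_less(2)[OF x] unfolding pt_def h_def
    by (cases rule: j_cases) (auto simp: rpow_eq_powr algebra_simps)
  ultimately show "(\<Psi> has_real_derivative rpow x (\<rho> j - 1) * h x) (at x within {0..L})"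
    by (simp add: sg_sq)
qed

text \<open>The amplitude \<open>k_j\<close> as a function of \<open>x\<close>: the singular power
  of \<open>x\<close> in \<open>U\<close> cancels against that in
  \<open>s powr (1 - \<mu> j)\<close>, leaving a power of \<open>E\<close>. This is what makes
  \<open>k_j\<close> smooth up to 0.\<close>

definition \<kappa> :: "real \<Rightarrow> complex" where
  "\<kappa> x = of_real (sg * (p 2 - p 1 - x) powr (\<mu> (3 - j) - 1) * E x powr (1 - \<mu> j) * D x powr (-1)) * ut (pt x)"

sublocale phase_expansion L "\<rho> j" N j h \<Psi> \<omega> "\<mu> j" \<kappa> w \<eta>
proof
  show "Ck_on N \<kappa> {0..L}"
    unfolding \<kappa>_def[abs_def]
    by (intro Ck_on_mult Ck_on_of_real Ck_compose_pt Ck_gap Ck_on_const Ck_on_powr Ck_E Ck_D E_pos D_pos ut L_pos)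
  show "w x = 1" if "x \<in> {0..\<eta>}" for x
    using that \<eta> p unfolding w_def pt_def by (cases rule: j_cases) (auto simp: \<nu>_1 \<nu>_0)
  show "flat_at N w {0..L} L"
  \<comment> \<open>The cut-off is considered up to the opposite endpoint, where it vanishes on a
    whole interval beyond \<open>L\<close>.\<close>
  proof (rule flat_at_subinterval[where b = "p 2 - p 1"])
    have pos: "0 < p 2 - p 1" using p by simp
    have "Ck_on N pt {0..p 2 - p 1}"
      unfolding pt_def[abs_def] by (rule Ck_on_affine[OF pos])
    then have "Ck_on N (\<lambda>x. \<nu> (pt x)) {0..p 2 - p 1}"
      by (rule Ck_on_compose[OF pos \<nu>]) (use pt_mem in blast)
    moreover from this have "Ck_on N (\<lambda>x. 1 - \<nu> (pt x)) {0..p 2 - p 1}"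
      by (rule Ck_on_const_diff[OF pos])
    ultimately show "Ck_on N w {0..p 2 - p 1}"
      unfolding w_def[abs_def] by (cases "j = 1") simp_all
    show "w x = 0" if "x \<in> {L..p 2 - p 1}" for x
      using that \<eta> p unfolding w_def pt_def L_def by (cases rule: j_cases) (auto simp: \<nu>_1 \<nu>_0)
  qed (use L_pos \<eta> in \<open>auto simp: L_def\<close>)
qed (use N1 \<mu> \<rho> j \<omega> \<eta> \<eta>_less_L in auto)

lemma phase_pt: "x \<in> {0..L} \<Longrightarrow> phase p \<rho> \<psi> j (pt x) = \<Phi> x"
  unfolding phase_def \<Phi>_def \<Psi>_def by (cases rule: j_cases) simp_all

lemma I_int_eq: "I_int p \<eta> j = pt ` {0..L}"
proof (intro equalityI subsetI)
  fix q assume "q \<in> I_int p \<eta> j"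
  then have "sg * (q - p j) \<in> {0..L}" "pt (sg * (q - p j)) = q"
    unfolding I_int_def pt_def L_def by (cases rule: j_cases; simp)+
  then show "q \<in> pt ` {0..L}" by (metis imageI)
next
  fix q assume "q \<in> pt ` {0..L}"
  then show "q \<in> I_int p \<eta> j"
    unfolding I_int_def pt_def L_def by (cases rule: j_cases) auto
qed

lemma s_end_eq: "s_end p \<rho> \<psi> \<eta> j = \<Phi> L"
  using phase_pt[of L, unfolded pt_def] L_pos unfolding s_end_def L_def
  by (cases rule: j_cases) (simp_all add: add.commute)

lemma phase_inv_eq:
  assumes s: "s \<in> {0..\<Phi> L}"
  shows "phase_inv p \<rho> \<psi> \<eta> j s = pt (X s)"
  unfolding phase_inv_def
proof (rule inv_into_f_eq)
  show "inj_on (phase p \<rho> \<psi> j) (I_int p \<eta> j)"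
    unfolding I_int_eq
  proof (rule inj_onI, elim imageE)
    fix q q' x y
    assume "phase p \<rho> \<psi> j q = phase p \<rho> \<psi> j q'" "q = pt x" "q' = pt y"
      and xy: "x \<in> {0..L}" "y \<in> {0..L}"
    then show "q = q'" using inj_onD[OF \<Phi>_inj _ xy] phase_pt[OF xy(1)] phase_pt[OF xy(2)] by simp
  qed
  show "pt (X s) \<in> I_int p \<eta> j"
    unfolding I_int_eq using X_mem[OF s] by blast
  show "phase p \<rho> \<psi> j (pt (X s)) = s"
    using phase_pt[OF X_mem[OF s]] \<Phi>_X[OF s] by simp
qed

lemma phase_inv_deriv:
  assumes s: "s \<in> {0..\<Phi> L}"
  shows "vector_derivative (phase_inv p \<rho> \<psi> \<eta> j) (at s within {0..\<Phi> L}) = sg / D (X s)"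
proof (rule vector_derivative_within_closed_interval[OF \<Phi>L_pos s])
  have "((\<lambda>s. pt (X s)) has_vector_derivative sg / D (X s)) (at s within {0..\<Phi> L})"
    using X_has_vector_derivative[OF s] unfolding pt_def
    by (auto intro!: derivative_eq_intros simp: has_real_derivative_iff_has_vector_derivative[symmetric])
  then show "(phase_inv p \<rho> \<psi> \<eta> j has_vector_derivative sg / D (X s)) (at s within {0..\<Phi> L})"
    by (rule has_vector_derivative_transform[OF s, rotated]) (simp add: phase_inv_eq)
qed

lemma U_pt:
  assumes "x \<in> {0<..L}"
  shows "U (pt x) = of_real (x powr (\<mu> j - 1) * (p 2 - p 1 - x) powr (\<mu> (3 - j) - 1)) * ut (pt x)"
proof -
  have "pt x \<in> {p 1<..<p 2}"
    using assms \<eta> unfolding pt_def L_def by (cases rule: j_cases) auto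
  then show ?thesis
    using U[of "pt x"] unfolding pt_def by (cases rule: j_cases) (simp_all add: algebra_simps)
qed

lemma \<kappa>_eq:
  assumes "x \<in> {0<..L}"
  shows "\<kappa> x * of_real (\<Phi> x powr (\<mu> j - 1) * D x) = of_real sg * U (pt x)"
proof -
  have x: "x \<in> {0..L}" "x > 0" using assms by auto
  have "E x powr (1 - \<mu> j) * \<Phi> x powr (\<mu> j - 1) = x powr (\<mu> j - 1) * (E x powr (1 - \<mu> j) * E x powr (\<mu> j - 1))"
    using x E_pos[of x] by (simp add: \<Phi>_eq powr_mult)
  also have "E x powr (1 - \<mu> j) * E x powr (\<mu> j - 1) = 1"
    unfolding powr_add[symmetric] using E_pos[OF x(1)] by simp
  finally have 1: "E x powr (1 - \<mu> j) * \<Phi> x powr (\<mu> j - 1) = x powr (\<mu> j - 1)" by simp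
  have 2: "D x powr (-1) * D x = 1"
    using D_pos[OF x(1)] by (simp add: powr_minus)
  have "sg * (p 2 - p 1 - x) powr (\<mu> (3 - j) - 1) * E x powr (1 - \<mu> j) * D x powr (-1) * (\<Phi> x powr (\<mu> j - 1) * D x)
      = sg * (p 2 - p 1 - x) powr (\<mu> (3 - j) - 1) * (E x powr (1 - \<mu> j) * \<Phi> x powr (\<mu> j - 1)) * (D x powr (-1) * D x)"
    by (simp only: mult_ac)
  also have "\<dots> = sg * (x powr (\<mu> j - 1) * (p 2 - p 1 - x) powr (\<mu> (3 - j) - 1))"
    unfolding 1 2 by (simp only: mult_ac mult_1)
  finally have eq: "sg * (p 2 - p 1 - x) powr (\<mu> (3 - j) - 1) * E x powr (1 - \<mu> j) * D x powr (-1) * (\<Phi> x powr (\<mu> j - 1) * D x)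
      = sg * (x powr (\<mu> j - 1) * (p 2 - p 1 - x) powr (\<mu> (3 - j) - 1))" .
  have "\<kappa> x * of_real (\<Phi> x powr (\<mu> j - 1) * D x) =
      of_real (sg * (p 2 - p 1 - x) powr (\<mu> (3 - j) - 1) * E x powr (1 - \<mu> j) * D x powr (-1) * (\<Phi> x powr (\<mu> j - 1) * D x)) * ut (pt x)"
    by (simp only: \<kappa>_def of_real_mult mult_ac)
  then show ?thesis
    unfolding eq U_pt[OF assms] by (simp only: of_real_mult mult_ac)
qed

lemma k_raw_eq:
  assumes s: "s \<in> {0<..\<Phi> L}"
  shows "k_raw p \<rho> \<mu> \<psi> U \<eta> j s = k s"
proof -
  have s': "s \<in> {0..\<Phi> L}" using s by simp
  have "X s \<noteq> 0" using \<Phi>_X[OF s'] \<Phi>_0 s by auto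
  then have x: "X s \<in> {0<..L}" using X_mem[OF s'] by simp
  have D: "D (X s) > 0" using D_pos x by simp
  have "s powr (1 - \<mu> j) * s powr (\<mu> j - 1) = 1"
    unfolding powr_add[symmetric] using s by simp
  then have "k s = of_real (s powr (1 - \<mu> j) * s powr (\<mu> j - 1) * (D (X s) / D (X s))) * \<kappa> (X s)"
    using D by (simp add: k_def)
  also have "\<dots> = of_real (s powr (1 - \<mu> j) / D (X s)) * (\<kappa> (X s) * of_real (\<Phi> (X s) powr (\<mu> j - 1) * D (X s)))"
    by (simp add: \<Phi>_X[OF s'])
  also have "\<dots> = k_raw p \<rho> \<mu> \<psi> U \<eta> j s"
    unfolding \<kappa>_eq[OF x] k_raw_def s_end_eq phase_inv_deriv[OF s'] phase_inv_eq[OF s'] by simp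
  finally show ?thesis ..
qed

text \<open>At 0 the left side is a limit of \<open>k_raw\<close>; it exists because
  \<open>k_raw\<close> agrees with the continuous \<open>k\<close> on the right of 0.\<close>

lemma k_fun_eq:
  assumes s: "s \<in> {0..\<Phi> L}"
  shows "k_fun p \<rho> \<mu> \<psi> U \<eta> j s = k s"
proof (cases "s = 0")
  case True
  have "continuous_on {0..\<Phi> L} k"
    unfolding k_def[abs_def] using X_mem
    by (intro continuous_on_compose2[OF Ck_on_imp_continuous_on[OF \<kappa>] Ck_on_imp_continuous_on[OF Ck_X]]) auto
  then have "(k \<longlongrightarrow> k 0) (at_right 0)"
    using \<Phi>L_pos by (auto simp: continuous_on_def at_within_Icc_at_right dest!: bspec[of _ _ 0])
  moreover have "\<forall>\<^sub>F s in at_right 0. k s = k_raw p \<rho> \<mu> \<psi> U \<eta> j s"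
    using eventually_at_right_real[OF \<Phi>L_pos] by eventually_elim (simp add: k_raw_eq)
  ultimately have "(k_raw p \<rho> \<mu> \<psi> U \<eta> j \<longlongrightarrow> k 0) (at_right 0)"
    by (rule Lim_transform_eventually)
  then show ?thesis using True by (simp add: k_fun_def tendsto_Lim)
next
  case False
  then show ?thesis using s k_raw_eq[of s] by (simp add: k_fun_def)
qed

lemma nu_fun_eq: "s \<in> {0..\<Phi> L} \<Longrightarrow> nu_fun p \<rho> \<psi> \<eta> \<nu> j s = w (X s)"
  using phase_inv_eq[of s] unfolding nu_fun_def w_def by (cases rule: j_cases) simp_all

lemma nu_k_deriv_eq:
  "s \<in> {0..\<Phi> L} \<Longrightarrow> nu_k_deriv p \<rho> \<mu> \<psi> U \<eta> \<nu> n j s = iter_deriv {0..\<Phi> L} n G s"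
  unfolding nu_k_deriv_def s_end_eq by (rule iter_deriv_cong) (simp_all add: nu_fun_eq k_fun_eq G_def)

lemma R_term_eq:
  "R_term p \<rho> \<mu> \<psi> U \<eta> \<nu> N j \<omega> = of_real sg * exp (\<i> * of_real (\<omega> * \<psi> (p j))) *
     ((-1) ^ N * integral {0..\<Phi> L} (\<lambda>s. phi_fun j N s \<omega> (\<rho> j) (\<mu> j) * iter_deriv {0..\<Phi> L} N G s))"
proof -
  have "integral {0..\<Phi> L} (\<lambda>s. phi_fun j N s \<omega> (\<rho> j) (\<mu> j) * nu_k_deriv p \<rho> \<mu> \<psi> U \<eta> \<nu> N j s) =
      integral {0..\<Phi> L} (\<lambda>s. phi_fun j N s \<omega> (\<rho> j) (\<mu> j) * iter_deriv {0..\<Phi> L} N G s)"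
    by (rule Henstock_Kurzweil_Integration.integral_cong) (simp add: nu_k_deriv_eq)
  then show ?thesis
    by (simp add: R_term_def s_end_eq sg_def power_add mult_ac)
qed

lemma A_term_eq:
  "A_term p \<rho> \<mu> \<psi> U \<eta> N j \<omega> = of_real sg * exp (\<i> * of_real (\<omega> * \<psi> (p j))) *
     - (\<Sum>n<N. (-1) ^ n * iter_deriv {0..\<Phi> L} n k 0 * phi_fun j (Suc n) 0 \<omega> (\<rho> j) (\<mu> j))"
proof -
  have "Theta_coeff j (Suc n) (\<rho> j) (\<mu> j) * iter_deriv {0..\<Phi> L} n (k_fun p \<rho> \<mu> \<psi> U \<eta> j) 0 *
        of_real (\<omega> powr (- ((real n + \<mu> j) / \<rho> j))) =
      - of_real sg * ((-1) ^ n * iter_deriv {0..\<Phi> L} n k 0 * phi_fun j (Suc n) 0 \<omega> (\<rho> j) (\<mu> j))" for n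
  proof -
    have "iter_deriv {0..\<Phi> L} n (k_fun p \<rho> \<mu> \<psi> U \<eta> j) 0 = iter_deriv {0..\<Phi> L} n k 0"
      using \<Phi>L_pos by (intro iter_deriv_cong k_fun_eq) auto
    \<comment> \<open>The signs from the orientation, from the repeated integration by parts and
      from the value of \<open>phi_fun\<close> at 0 cancel.\<close>
    moreover have "- of_real sg * (-1) ^ n * (-1) ^ (n + j) = (1 :: complex)"
      by (cases "even n"; cases "even j") (simp_all add: sg_def power_add)
    moreover have "- of_real sg * ((-1) ^ n * d * ((-1) ^ (n + j) * t * c)) =
        (- of_real sg * (-1) ^ n * (-1) ^ (n + j)) * (t * d * c)" for t d c :: complex
      by (simp add: mult_ac)
    ultimately show ?thesis
      unfolding phi_fun_at_0 by (simp only: mult_1_left)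
  qed
  then show ?thesis
    unfolding A_term_def s_end_eq by (simp add: sum_distrib_left[symmetric] sum_negf mult_ac)
qed

text \<open>The constant phase at \<open>p j\<close> recombines with \<open>osc\<close>, since the
  signed power of \<open>\<Phi> x\<close> is the phase increment, and the Jacobian \<open>D\<close>
  turns \<open>\<kappa>\<close> back into \<open>U\<close>.\<close>

lemma has_integral_pt:
  "((\<lambda>x. of_real (w x) * (U (pt x) * exp (\<i> * of_real (\<omega> * \<psi> (pt x))))) has_integral
     A_term p \<rho> \<mu> \<psi> U \<eta> N j \<omega> + R_term p \<rho> \<mu> \<psi> U \<eta> \<nu> N j \<omega>) {0..L}"
proof -
  let ?c = "of_real sg * exp (\<i> * of_real (\<omega> * \<psi> (p j)))"
  have "((\<lambda>x. ?c * (of_real (w x) * \<kappa> x * of_real (D x) * osc j \<omega> (\<rho> j) (\<mu> j) (of_real (\<Phi> x)))) has_integral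
      A_term p \<rho> \<mu> \<psi> U \<eta> N j \<omega> + R_term p \<rho> \<mu> \<psi> U \<eta> \<nu> N j \<omega>) {0..L}"
    unfolding A_term_eq R_term_eq distrib_left[symmetric]
    by (intro has_integral_mult_right has_integral_expansion)
  then show ?thesis
  \<comment> \<open>The identity of the integrands uses \<open>\<Phi> x > 0\<close>; the single
    point 0 is negligible.\<close>
  proof (rule has_integral_spike_finite[of "{0}", rotated 2])
    fix x assume "x \<in> {0..L} - {0}"
    then have x: "x \<in> {0<..L}" "x \<in> {0..L}" by auto
    have pos: "\<Phi> x > 0" using \<Phi>_strict_mono[of 0 x] \<Phi>_0 x by simp
    have \<Phi>_\<rho>: "of_real (\<Phi> x) powr of_real (\<rho> j) = (of_real (\<Psi> x) :: complex)"
      using \<Phi>_powr[OF x(2)] pos by (simp add: powr_of_real)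
    have \<Psi>_sg: "(-1) ^ (j + 1) * of_real (\<Psi> x) = (of_real (\<psi> (pt x) - \<psi> (p j)) :: complex)"
      unfolding \<Psi>_def by (cases rule: j_cases) simp_all
    have "(-1) ^ (j + 1) * \<i> * of_real \<omega> * of_real (\<Phi> x) powr of_real (\<rho> j) =
        \<i> * of_real \<omega> * ((-1) ^ (j + 1) * of_real (\<Psi> x))"
      by (simp only: \<Phi>_\<rho> mult_ac)
    also have "\<dots> = \<i> * of_real (\<omega> * (\<psi> (pt x) - \<psi> (p j)))"
      unfolding \<Psi>_sg by (simp only: of_real_mult mult.assoc)
    finally have osc: "osc j \<omega> (\<rho> j) (\<mu> j) (of_real (\<Phi> x)) =
        of_real (\<Phi> x powr (\<mu> j - 1)) * exp (\<i> * of_real (\<omega> * (\<psi> (pt x) - \<psi> (p j))))"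
      unfolding osc_def using pos powr_of_real[of "\<Phi> x" "\<mu> j - 1"] by (simp del: of_real_diff)
    have exp: "exp (\<i> * of_real (\<omega> * \<psi> (p j))) * exp (\<i> * of_real (\<omega> * (\<psi> (pt x) - \<psi> (p j)))) =
        exp (\<i> * of_real (\<omega> * \<psi> (pt x)))"
      by (simp add: algebra_simps flip: exp_add)
    have U: "of_real sg * (\<kappa> x * of_real (\<Phi> x powr (\<mu> j - 1) * D x)) = U (pt x)"
      unfolding \<kappa>_eq[OF x(1)] mult.assoc[symmetric] of_real_mult[symmetric] sg_sq by simp
    show "of_real (w x) * (U (pt x) * exp (\<i> * of_real (\<omega> * \<psi> (pt x)))) =
        ?c * (of_real (w x) * \<kappa> x * of_real (D x) * osc j \<omega> (\<rho> j) (\<mu> j) (of_real (\<Phi> x)))"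
      unfolding U[symmetric] exp[symmetric] osc by (simp only: of_real_mult mult_ac)
  qed simp
qed

lemma norm_R_term_le:
  "norm (R_term p \<rho> \<mu> \<psi> U \<eta> \<nu> N j \<omega>) \<le>
     1 / fact (N - 1) * (1 / \<rho> j) * Gamma (real N / \<rho> j) *
     integral {0..s_end p \<rho> \<psi> \<eta> j} (\<lambda>s. s powr (\<mu> j - 1) * norm (nu_k_deriv p \<rho> \<mu> \<psi> U \<eta> \<nu> N j s)) *
     \<omega> powr (- (real N / \<rho> j))"
proof -
  have "integral {0..\<Phi> L} (\<lambda>s. s powr (\<mu> j - 1) * norm (nu_k_deriv p \<rho> \<mu> \<psi> U \<eta> \<nu> N j s)) =
      integral {0..\<Phi> L} (\<lambda>s. s powr (\<mu> j - 1) * norm (iter_deriv {0..\<Phi> L} N G s))"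
    by (rule Henstock_Kurzweil_Integration.integral_cong) (simp add: nu_k_deriv_eq)
  moreover have "continuous_on {0..\<Phi> L} (iter_deriv {0..\<Phi> L} N G)"
    using flat_G by (intro Ck_on_continuous_on_iter_deriv[of N]) (auto simp: flat_at_def)
  moreover have "norm (of_real sg :: complex) = 1"
    by (cases rule: j_cases) auto
  ultimately show ?thesis
    using norm_integral_phi_fun_le[OF \<Phi>L_pos N1, of "iter_deriv {0..\<Phi> L} N G"]
    unfolding R_term_eq s_end_eq norm_mult by (simp add: norm_power)
qed

text \<open>An affine substitution returns to the original variable, and outside
  \<open>I_int\<close> the cut-off is zero, so the piece extends to the whole interval.\<close>

lemma has_integral_piece:
  "((\<lambda>q. of_real (if j = 1 then \<nu> q else 1 - \<nu> q) * (U q * exp (\<i> * of_real (\<omega> * \<psi> q)))) has_integral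
     A_term p \<rho> \<mu> \<psi> U \<eta> N j \<omega> + R_term p \<rho> \<mu> \<psi> U \<eta> \<nu> N j \<omega>) {p 1..p 2}"
proof -
  define g where "g = (\<lambda>q. of_real (if j = 1 then \<nu> q else 1 - \<nu> q) * (U q * exp (\<i> * of_real (\<omega> * \<psi> q))))"
  let ?I = "A_term p \<rho> \<mu> \<psi> U \<eta> N j \<omega> + R_term p \<rho> \<mu> \<psi> U \<eta> \<nu> N j \<omega>"
  have sg: "sg \<noteq> 0" "\<bar>sg\<bar> = 1" "1 / sg = sg" by (cases rule: j_cases; simp)+
  have "((\<lambda>x. g (pt x)) has_integral ?I) (cbox 0 L)"
    using has_integral_pt by (simp add: w_def g_def)
  from has_integral_affinity[OF this sg(1), of "- sg * p j"]
  have "((\<lambda>q. g (pt (sg * q + - sg * p j))) has_integral ?I) ((\<lambda>x. sg * x + p j) ` {0..L})"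
    using sg sg_sq by (simp add: mult.assoc[symmetric])
  moreover have "pt (sg * q + - sg * p j) = q" for q
    unfolding pt_def by (cases rule: j_cases) simp_all
  moreover have "(\<lambda>x. sg * x + p j) ` {0..L} = I_int p \<eta> j"
    unfolding I_int_eq by (rule image_cong) (simp_all add: pt_def)
  ultimately have "(g has_integral ?I) (I_int p \<eta> j)"
    by (simp only:)
  moreover have "I_int p \<eta> j \<subseteq> {p 1..p 2}"
    using \<eta> by (auto simp: I_int_def)
  ultimately have "((\<lambda>q. if q \<in> I_int p \<eta> j then g q else 0) has_integral ?I) {p 1..p 2}"
    by (subst has_integral_restrict)
  then have "(g has_integral ?I) {p 1..p 2}"
  proof (rule has_integral_eq[rotated])
    fix q assume "q \<in> {p 1..p 2}"
    then show "(if q \<in> I_int p \<eta> j then g q else 0) = g q"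
      using j \<nu>_1[of q] \<nu>_0[of q] by (auto simp: I_int_def g_def)
  qed
  then show ?thesis by (simp only: g_def)
qed

end

theorem theorem1p3:
  fixes p \<rho> \<mu> :: "nat \<Rightarrow> real" and \<eta> \<omega> :: real and N :: nat
    and \<psi> \<psi>t \<nu> :: "real \<Rightarrow> real" and U ut :: "real \<Rightarrow> complex"
  assumes "p 1 < p 2" and "N \<ge> 1"
    and "\<forall>j\<in>{1, 2}. \<rho> j \<ge> 1" and "\<forall>j\<in>{1, 2}. 0 < \<mu> j \<and> \<mu> j < 1"
    and "Ck_on 1 \<psi> {p 1..p 2}"
    and "\<forall>q\<in>{p 1..p 2}. (\<psi> has_real_derivative
           rpow (q - p 1) (\<rho> 1 - 1) * rpow (p 2 - q) (\<rho> 2 - 1) * \<psi>t q) (at q within {p 1..p 2})"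
    and "Ck_on N \<psi>t {p 1..p 2}" and "\<forall>q\<in>{p 1..p 2}. \<psi>t q > 0"
    and "\<forall>q\<in>{p 1<..<p 2}.
           U q = of_real ((q - p 1) powr (\<mu> 1 - 1) * (p 2 - q) powr (\<mu> 2 - 1)) * ut q"
    and "Ck_on N ut {p 1..p 2}" and "\<forall>j\<in>{1, 2}. ut (p j) \<noteq> 0"
    and "0 < \<eta>" and "\<eta> < (p 2 - p 1) / 2"
    and "\<forall>n. Ck_on n \<nu> {p 1..p 2}" and "\<forall>q\<in>{p 1..p 2}. 0 \<le> \<nu> q \<and> \<nu> q \<le> 1"
    and "\<forall>q\<in>{p 1..p 1 + \<eta>}. \<nu> q = 1" and "\<forall>q\<in>{p 2 - \<eta>..p 2}. \<nu> q = 0"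
    and "\<omega> > 0"
  shows "((\<lambda>q. U q * exp (\<i> * of_real (\<omega> * \<psi> q))) has_integral
            (\<Sum>j\<in>{1, 2}. A_term p \<rho> \<mu> \<psi> U \<eta> N j \<omega> + R_term p \<rho> \<mu> \<psi> U \<eta> \<nu> N j \<omega>)) {p 1<..<p 2}
       \<and> (\<forall>j\<in>{1, 2}. norm (R_term p \<rho> \<mu> \<psi> U \<eta> \<nu> N j \<omega>) \<le>
            1 / fact (N - 1) * (1 / \<rho> j) * Gamma (real N / \<rho> j) *
            integral {0..s_end p \<rho> \<psi> \<eta> j}
              (\<lambda>s. s powr (\<mu> j - 1) * norm (nu_k_deriv p \<rho> \<mu> \<psi> U \<eta> \<nu> N j s)) *
            \<omega> powr (- (real N / \<rho> j)))"
proof -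
  have set: "setting p \<rho> \<mu> \<eta> \<omega> N j \<psi> \<psi>t \<nu> U ut" if "j \<in> {1, 2}" for j
    using assms that by unfold_locales auto
  have g: "((\<lambda>q. of_real (if j = 1 then \<nu> q else 1 - \<nu> q) * (U q * exp (\<i> * of_real (\<omega> * \<psi> q)))) has_integral
     A_term p \<rho> \<mu> \<psi> U \<eta> N j \<omega> + R_term p \<rho> \<mu> \<psi> U \<eta> \<nu> N j \<omega>) {p 1..p 2}" if "j \<in> {1, 2}" for j
    using setting.has_integral_piece[OF set[OF that]] .
  have "((\<lambda>q. \<Sum>j\<in>{1, 2::nat}. of_real (if j = 1 then \<nu> q else 1 - \<nu> q) * (U q * exp (\<i> * of_real (\<omega> * \<psi> q)))) has_integral
      (\<Sum>j\<in>{1, 2}. A_term p \<rho> \<mu> \<psi> U \<eta> N j \<omega> + R_term p \<rho> \<mu> \<psi> U \<eta> \<nu> N j \<omega>)) {p 1..p 2}"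
    using g by (intro has_integral_sum) auto
  \<comment> \<open>The two cut-offs \<open>\<nu>\<close> and \<open>1 - \<nu>\<close> add up to
    1.\<close>
  then have "((\<lambda>q. U q * exp (\<i> * of_real (\<omega> * \<psi> q))) has_integral
      (\<Sum>j\<in>{1, 2}. A_term p \<rho> \<mu> \<psi> U \<eta> N j \<omega> + R_term p \<rho> \<mu> \<psi> U \<eta> \<nu> N j \<omega>)) {p 1..p 2}"
    by (rule has_integral_eq[rotated]) (simp add: algebra_simps)
  \<comment> \<open>\<open>U\<close> is prescribed only on the open interval; dropping the two
    endpoints does not change the integral.\<close>
  then show ?thesis
    using setting.norm_R_term_le[OF set] by (auto simp: has_integral_Icc_iff_Ioo simp del: sum.insert)
qed

end
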